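(* Let $G$ be a group. Then $G$ admits presentation by a finite convergent length-reducing rewriting system $(\Sigma, T)$ such that $\Sigma=\Sigma^{-1}$ and the left-hand side of every rule has length at most three if and only if $G$ is plain.
   Context: A rewriting system is a pair $(\Sigma,T)$ where $\Sigma$ is a nonempty alphabet and $T\subseteq \Sigma^*\times\Sigma^*$ is a set of rules $(\ell,r)$. It determines the relation $u\ell v\to urv$ for $(\ell,r)\in T$; $\overset{*}{\to}$ is its reflexive transitive closure, and $\overset{*}{\leftrightarrow}$ its reflexive, symmetric, transitive closure. The monoid presented is $\Sigma^*/\overset{*}{\leftrightarrow}$ under concatenation; if every class has an inverse it is a group, the group presented by $(\Sigma,T)$. The system is finite if $\Sigma$ and $T$ are finite; length-reducing if $|\ell|>|r|$ for all $(\ell,r)\in T$; terminating if there is no infinite sequence of rewrites; confluent if whenever $w\overset{*}{\to}x$ and $w\overset{*}{\to}y$ there is $z$ with $x\overset{*}{\to}z$ and $y\overset{*}{\to}z$; convergent if terminating and confluent. The condition $\Sigma=\Sigma^{-1}$ means the alphabet is closed under inverses: for each letter there is a letter of $\Sigma$ representing its inverse in $G$. A group is plain if it is isomorphic to a free product of finitely many factors, each a finite group or an infinite cyclic group. *)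

theory Defs
  imports "HOL-Algebra.Algebra"
begin

section \<open>String rewriting systems\<close>

text \<open>One-step rewrite relation: u l v -> u r v for (l,r) in T.\<close>
definition rstep :: "('a list \<times> 'a list) set \<Rightarrow> ('a list \<times> 'a list) set" where
  "rstep T = {(u @ l @ v, u @ r @ v) | u l r v. (l, r) \<in> T}"

text \<open>Reflexive, symmetric, transitive closure of the rewrite relation.\<close>
definition conv :: "('a list \<times> 'a list) set \<Rightarrow> ('a list \<times> 'a list) set" where
  "conv T = (rstep T \<union> (rstep T)\<inverse>)\<^sup>*"

definition finite_rs :: "'a set \<Rightarrow> ('a list \<times> 'a list) set \<Rightarrow> bool" where
  "finite_rs \<Sigma> T \<longleftrightarrow> \<Sigma> \<noteq> {} \<and> finite \<Sigma> \<and> finite T \<and> T \<subseteq> lists \<Sigma> \<times> lists \<Sigma>"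

definition length_reducing :: "('a list \<times> 'a list) set \<Rightarrow> bool" where
  "length_reducing T \<longleftrightarrow> (\<forall>(l, r) \<in> T. length l > length r)"

text \<open>No infinite sequence of rewrites starting from a word over the alphabet.\<close>
definition terminating :: "'a set \<Rightarrow> ('a list \<times> 'a list) set \<Rightarrow> bool" where
  "terminating \<Sigma> T \<longleftrightarrow>
     \<not> (\<exists>f :: nat \<Rightarrow> 'a list. f 0 \<in> lists \<Sigma> \<and> (\<forall>i. (f i, f (Suc i)) \<in> rstep T))"

definition confluent :: "'a set \<Rightarrow> ('a list \<times> 'a list) set \<Rightarrow> bool" where
  "confluent \<Sigma> T \<longleftrightarrow>
     (\<forall>w \<in> lists \<Sigma>. \<forall>x y. (w, x) \<in> (rstep T)\<^sup>* \<and> (w, y) \<in> (rstep T)\<^sup>* \<longrightarrow>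
        (\<exists>z. (x, z) \<in> (rstep T)\<^sup>* \<and> (y, z) \<in> (rstep T)\<^sup>*))"

definition convergent :: "'a set \<Rightarrow> ('a list \<times> 'a list) set \<Rightarrow> bool" where
  "convergent \<Sigma> T \<longleftrightarrow> terminating \<Sigma> T \<and> confluent \<Sigma> T"

text \<open>phi is an isomorphism from the monoid presented by (Sigma, T), i.e.
  Sigma^* modulo conv T, onto G: phi is a surjective monoid homomorphism
  from Sigma^* to G whose kernel congruence is exactly conv T.\<close>
definition presentation_map ::
  "('g, 'b) monoid_scheme \<Rightarrow> 'a set \<Rightarrow> ('a list \<times> 'a list) set \<Rightarrow> ('a list \<Rightarrow> 'g) \<Rightarrow> bool" where
  "presentation_map G \<Sigma> T \<phi> \<longleftrightarrow>
     \<phi> ` lists \<Sigma> = carrier G \<and>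
     \<phi> [] = \<one>\<^bsub>G\<^esub> \<and>
     (\<forall>u \<in> lists \<Sigma>. \<forall>v \<in> lists \<Sigma>. \<phi> (u @ v) = \<phi> u \<otimes>\<^bsub>G\<^esub> \<phi> v) \<and>
     (\<forall>u \<in> lists \<Sigma>. \<forall>v \<in> lists \<Sigma>. \<phi> u = \<phi> v \<longleftrightarrow> (u, v) \<in> conv T)"

text \<open>Sigma = Sigma^{-1}: every letter has a letter representing its inverse in G.\<close>
definition inverse_closed ::
  "('g, 'b) monoid_scheme \<Rightarrow> 'a set \<Rightarrow> ('a list \<Rightarrow> 'g) \<Rightarrow> bool" where
  "inverse_closed G \<Sigma> \<phi> \<longleftrightarrow>
     (\<forall>a \<in> \<Sigma>. \<exists>b \<in> \<Sigma>. \<phi> [b] = inv\<^bsub>G\<^esub> (\<phi> [a]))"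

section \<open>Plain groups\<close>

definition infinite_cyclic_subgroup :: "('g, 'b) monoid_scheme \<Rightarrow> 'g set \<Rightarrow> bool" where
  "infinite_cyclic_subgroup G H \<longleftrightarrow> infinite H \<and> (\<exists>g \<in> carrier G. H = generate G {g})"

text \<open>G is the (internal) free product of the subgroups H 0, ..., H (n-1):
  they generate G and no nonempty reduced alternating word
  h_1 ... h_k (h_j in H (i_j) - {1}, consecutive indices distinct) equals 1.
  This is the normal form characterisation: G is then isomorphic to the
  external free product of the H i.\<close>
definition free_product_of :: "('g, 'b) monoid_scheme \<Rightarrow> nat \<Rightarrow> (nat \<Rightarrow> 'g set) \<Rightarrow> bool" where
  "free_product_of G n H \<longleftrightarrow>
     (\<forall>i < n. subgroup (H i) G) \<and>
     generate G (\<Union>i<n. H i) = carrier G \<and>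
     (\<forall>ws :: (nat \<times> 'g) list.
        ws \<noteq> [] \<and>
        (\<forall>(i, h) \<in> set ws. i < n \<and> h \<in> H i \<and> h \<noteq> \<one>\<^bsub>G\<^esub>) \<and>
        successively (\<lambda>x y. fst x \<noteq> fst y) ws
        \<longrightarrow> foldr (\<lambda>p acc. snd p \<otimes>\<^bsub>G\<^esub> acc) ws \<one>\<^bsub>G\<^esub> \<noteq> \<one>\<^bsub>G\<^esub>)"

definition plain_group :: "('g, 'b) monoid_scheme \<Rightarrow> bool" where
  "plain_group G \<longleftrightarrow>
     (\<exists>n H. free_product_of G n H \<and>
        (\<forall>i < n. finite (H i) \<or> infinite_cyclic_subgroup G (H i)))"

end

theory Submission
  imports Defs
begin

text \<open>
  From a rewriting system to a plain group. Irreducible words are the unique geodesic words, and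
  since left-hand sides have length at most three, a word is geodesic as soon as its factors of
  length three are. Hence in the Cayley graph a walk all of whose subwalks of length three are
  geodesic is the unique shortest walk between its ends. This forces every isometric circuit to
  be a triangle or a pentagon, and moreover forces the relation "equal, adjacent, or at distance
  two on a common isometric pentagon" to hold between any two vertices of a common block, so that
  blocks have diameter at most two. Let A be the finite set of nontrivial elements related to the
  identity. A product of elements of A in which no two neighbours lie in a common block expands to
  a locally geodesic walk and is therefore nontrivial. The blocks through the identity, with the
  translations by elements of A that map one of them to another, form a finite groupoid, whose
  arrows are the elements of A and the identities. In each component choose a root and an arrow
  from it to every other object: the group is the free product of the finite vertex groups at the
  roots and the infinite cyclic groups generated by the chosen arrows.

  Conversely, take as letters the nontrivial elements of the finite factors and the generators of
  the infinite cyclic factors with their inverses, and rewrite a product of two letters of the same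
  factor to the letter (or empty word) it represents.
\<close>

section \<open>Locally geodesic walks\<close>

text \<open>Balls of radius one and, with \<open>near2\<close>, of radius two, so that no metric on
  the graph has to be set up.\<close>

definition near1 :: "('v \<Rightarrow> 'v \<Rightarrow> bool) \<Rightarrow> 'v \<Rightarrow> 'v \<Rightarrow> bool" where
  "near1 E x y \<longleftrightarrow> x = y \<or> E x y"

definition near2 :: "('v \<Rightarrow> 'v \<Rightarrow> bool) \<Rightarrow> 'v \<Rightarrow> 'v \<Rightarrow> bool" where
  "near2 E x y \<longleftrightarrow> near1 E x y \<or> (\<exists>z. E x z \<and> E z y)"

text \<open>Every subwalk of at most three edges has to be geodesic; three is the bound on left-hand
  sides. The empty list is excluded because walks are compared by their first and last
  vertices.\<close>

fun local_geodesic :: "('v \<Rightarrow> 'v \<Rightarrow> bool) \<Rightarrow> 'v list \<Rightarrow> bool" where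
  "local_geodesic E [] = False"
| "local_geodesic E [x] = True"
| "local_geodesic E [x, y] = E x y"
| "local_geodesic E [x, y, z] = (E x y \<and> E y z \<and> \<not> near1 E x z)"
| "local_geodesic E (x # y # z # w # ws) =
     (E x y \<and> \<not> near1 E x z \<and> \<not> near2 E x w \<and> local_geodesic E (y # z # w # ws))"

lemma local_geodesicD:
  assumes "local_geodesic E (x # y # zs)"
  shows "E x y" "local_geodesic E (y # zs)" "zs \<noteq> [] \<Longrightarrow> \<not> near1 E x (hd zs)"
    "zs \<noteq> [] \<Longrightarrow> tl zs \<noteq> [] \<Longrightarrow> \<not> near2 E x (hd (tl zs))"
  using assms by (cases zs rule: remdups_adj.cases; simp)+

text \<open>Besides symmetry and the absence of loops, the block analysis uses one fact about the
  Cayley graph: a local geodesic admits neither a shortcut nor a second walk of the same length.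
  Impossible configurations are refuted by exhibiting two walks between the same ends.\<close>

locale local_geodetic =
  fixes E :: "'v \<Rightarrow> 'v \<Rightarrow> bool"
  assumes sym: "E x y \<Longrightarrow> E y x"
    and irrefl: "\<not> E x x"
    and local_geodesic_unique:
      "local_geodesic E p \<Longrightarrow> q \<noteq> [] \<Longrightarrow> successively E q \<Longrightarrow> hd q = hd p \<Longrightarrow>
       last q = last p \<Longrightarrow> length q \<le> length p \<Longrightarrow> q = p"
begin

abbreviation N1 where "N1 \<equiv> near1 E"
abbreviation N2 where "N2 \<equiv> near2 E"

lemma near1_sym: "N1 x y \<Longrightarrow> N1 y x"
  unfolding near1_def using sym by blast

lemma near2_sym: "N2 x y \<Longrightarrow> N2 y x"
  unfolding near2_def using sym near1_sym by blast

lemma midpoint_unique: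
  assumes "E x m" "E m y" "E x n" "E n y" "\<not> N1 x y"
  shows "m = n"
  using local_geodesic_unique[of "[x, m, y]" "[x, n, y]"] assms by simp

lemma geodesic3_unique:
  assumes "E a b" "E b c" "E c d" "E a b'" "E b' c'" "E c' d" "\<not> N2 a d"
  shows "b = b' \<and> c = c'"
proof -
  have "\<not> N1 a c" "\<not> N1 b d"
    using assms unfolding near1_def near2_def by metis+
  then show ?thesis
    using local_geodesic_unique[of "[a, b, c, d]" "[a, b', c', d]"] assms by simp
qed

text \<open>Checking the two subwalks of three edges suffices, although the conclusion concerns a
  walk of four edges. The harder refutations below rest on this gain.\<close>

lemma geodesic4:
  assumes "E a b" "E b c" "E c d" "E d e" "\<not> N2 a d" "\<not> N2 b e"
  shows geodesic4_unique: "\<lbrakk>E a b'; E b' c'; E c' d'; E d' e\<rbrakk> \<Longrightarrow> b = b' \<and> c = c' \<and> d = d'"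
    and geodesic4_not3: "\<lbrakk>E a b'; E b' c'; E c' e\<rbrakk> \<Longrightarrow> False"
proof -
  have "\<not> N1 a c" "\<not> N1 b d" "\<not> N1 c e"
    using assms unfolding near1_def near2_def by metis+
  then have g: "local_geodesic E [a, b, c, d, e]" using assms by simp
  show "\<lbrakk>E a b'; E b' c'; E c' d'; E d' e\<rbrakk> \<Longrightarrow> b = b' \<and> c = c' \<and> d = d'"
    using local_geodesic_unique[OF g, of "[a, b', c', d', e]"] by simp
  show "\<lbrakk>E a b'; E b' c'; E c' e\<rbrakk> \<Longrightarrow> False"
    using local_geodesic_unique[OF g, of "[a, b', c', e]"] by simp
qed

section \<open>Isometric pentagons and the block relation\<close>

definition pentagon where
  "pentagon a b c d e \<longleftrightarrow> E a b \<and> E b c \<and> E c d \<and> E d e \<and> E e a \<and>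
     \<not> N1 a c \<and> \<not> N1 b d \<and> \<not> N1 c e \<and> \<not> N1 d a \<and> \<not> N1 e b"

lemma pentagon_rotate: "pentagon a b c d e \<Longrightarrow> pentagon b c d e a"
  unfolding pentagon_def by blast

lemma pentagon_reverse: "pentagon a b c d e \<Longrightarrow> pentagon e d c b a"
  unfolding pentagon_def using sym near1_sym by blast

text \<open>If \<open>a\<close> and \<open>d\<close> were adjacent, \<open>b\<close> and
  \<open>d\<close> would both be midpoints of \<open>a\<close> and \<open>c\<close>. So their
  distance is two and a midpoint \<open>e\<close> closes the cycle; a chord at \<open>e\<close>
  would again give two midpoints to a pair at distance two.\<close>

lemma pentagonI:
  assumes "E a b" "E b c" "E c d" "\<not> N1 a c" "\<not> N1 b d" "N2 a d"
  obtains e where "pentagon a b c d e"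
proof -
  have "\<not> N1 a d"
    using assms midpoint_unique[of a b c d] sym unfolding near1_def by blast
  then obtain e where e: "E a e" "E e d" using assms(6) unfolding near2_def by blast
  have "e \<noteq> b" using e assms unfolding near1_def by blast
  have "\<not> N1 e c"
    using assms midpoint_unique[of a b c e] sym e \<open>e \<noteq> b\<close> unfolding near1_def by blast
  moreover have "\<not> N1 e b"
    using assms midpoint_unique[of b c d e] sym e \<open>e \<noteq> b\<close> irrefl unfolding near1_def by blast
  ultimately have "pentagon a b c d e"
    unfolding pentagon_def using assms e \<open>\<not> N1 a d\<close> sym near1_sym by blast
  then show thesis by (rule that)
qed

text \<open>It turns out that this relates exactly the pairs of vertices in a common block of the graph.\<close>
definition same_block where
  "same_block a c \<longleftrightarrow> N1 a c \<or> (\<exists>b d e. pentagon a b c d e)"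

lemma same_block_refl: "same_block a a"
  and same_block_edge: "E a b \<Longrightarrow> same_block a b"
  and same_block_near1: "N1 a b \<Longrightarrow> same_block a b"
  unfolding same_block_def near1_def by auto

lemma same_block_sym: "same_block a b \<Longrightarrow> same_block b a"
proof -
  have "pentagon b x a e d" if "pentagon a x b d e" for x d e
    using that pentagon_reverse pentagon_rotate by blast
  then show "same_block a b \<Longrightarrow> same_block b a" unfolding same_block_def using near1_sym by blast
qed

lemma same_block_near2: "same_block a b \<Longrightarrow> N2 a b"
  unfolding same_block_def pentagon_def near2_def by blast

lemma pentagon_D:
  assumes "pentagon a b c d e"
  shows "same_block a c" "same_block b d" "same_block c e" "same_block d a" "same_block e b" "same_block c a" "same_block d b" "same_block e c" "same_block a d" "same_block b e"
proof -
  note r = pentagon_rotate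
  have D: "same_block a c" if "pentagon a b c d e" for a b c d e
    using that unfolding same_block_def by blast
  show "same_block a c" "same_block b d" "same_block c e" "same_block d a" "same_block e b"
    using D[OF assms] D[OF r[OF assms]] D[OF r[OF r[OF assms]]] D[OF r[OF r[OF r[OF assms]]]]
      D[OF r[OF r[OF r[OF r[OF assms]]]]] by blast+
  then show "same_block c a" "same_block d b" "same_block e c" "same_block a d" "same_block b e"
    using same_block_sym by blast+
qed

text \<open>Midpoints are unique, so a pentagon with diagonal \<open>a\<close>, \<open>c\<close>
  already passes through the given \<open>b\<close>.\<close>

lemma same_block_pentagonE:
  assumes "same_block a c" "\<not> N1 a c" "E a b" "E b c"
  obtains d e where "pentagon a b c d e"
  using assms midpoint_unique[of a b c] unfolding same_block_def pentagon_def by metis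

lemma same_block_midpointE:
  assumes "same_block a c" "\<not> N1 a c"
  obtains b where "E a b" "E b c"
  using assms unfolding same_block_def pentagon_def by metis

text \<open>Contrapositive of \<open>pentagonI\<close>: ends within distance two would close the
  walk to a pentagon with diagonal \<open>a\<close>, \<open>c\<close>.\<close>

lemma not_D_near2:
  assumes "\<not> same_block a c" "E a b" "E b c" "E c d" "\<not> N1 b d"
  shows "\<not> N2 a d"
  using assms pentagonI[of a b c d] pentagon_D unfolding same_block_def by metis

text \<open>Split by which of the pairs \<open>a\<close>, \<open>b\<close> and \<open>b\<close>,
  \<open>c\<close> are adjacent. Two edges give \<open>a\<close> and \<open>c\<close> two midpoints;
  an edge and a pentagon give a second walk of three edges; two pentagons, glued along the edge from
  \<open>y\<close> to \<open>b\<close>, give a second walk of four edges.\<close>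

lemma same_block_trans_neighbours:
  assumes "E y a" "E y b" "E y c" "same_block a b" "same_block b c"
  shows "same_block a c"
proof (rule ccontr)
  assume nD: "\<not> same_block a c"
  then have nN: "\<not> N1 a c" "\<not> N1 c a" using same_block_near1 near1_sym by blast+
  have nD': "\<not> same_block c a" using nD same_block_sym by blast
  have mixed: False
    if h: "E y a" "E y b" "E y c" "\<not> same_block a c" "E a b" "same_block b c" "\<not> N1 b c" for a b c
  proof -
    obtain p q where P: "pentagon b y c p q"
      using same_block_pentagonE[OF h(6,7)] sym h by metis
    have "\<not> N2 a p"
      using not_D_near2[OF h(4), of y p] P h sym unfolding pentagon_def by blast
    then show False
      using geodesic3_unique[of a y c p b q] P h sym unfolding pentagon_def near1_def by blast
  qed
  have "a \<noteq> b" "b \<noteq> c" using nD assms by auto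
  show False
  proof (cases "E a b")
    case True
    show False
    proof (cases "E b c")
      case True
      then show False
        using midpoint_unique[of a y c b] \<open>E a b\<close> assms sym nN irrefl by metis
    next
      case False
      then show False using mixed[of a b c] assms nD True \<open>b \<noteq> c\<close> by (simp add: near1_def)
    qed
  next
    case nab: False
    show False
    proof (cases "E b c")
      case True
      then show False using mixed[of c b a] assms nD' sym same_block_sym \<open>a \<noteq> b\<close> nab by (metis near1_def)
    next
      case False
      obtain p q where P: "pentagon a y b q p"
        using same_block_pentagonE[of a b y] sym assms nab \<open>a \<noteq> b\<close> by (metis near1_def)
      obtain r s where R: "pentagon b y c s r"
        using same_block_pentagonE[of b c y] sym assms False \<open>b \<noteq> c\<close> by (metis near1_def)
      have e: "E p a" "E a y" "E y c" "E c s" "E p q" "E q b" "E b r" "E r s"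
        and n: "\<not> N1 y s" "\<not> N1 y p"
        using P R sym near1_sym unfolding pentagon_def by blast+
      have "\<not> N2 a s" using not_D_near2[OF nD e(2,3,4) n(1)] .
      moreover have "\<not> N2 p c"
        using not_D_near2[OF nD', of y p] n(2) e sym near2_sym by blast
      ultimately have "q = a \<and> b = y"
        \<comment> \<open>The vertices \<open>p\<close> and \<open>s\<close> cut the outer boundary
          of the glued pentagons into two walks of four edges, one through \<open>y\<close> and one
          through \<open>b\<close>.\<close>
        using geodesic4_unique[of p a y c s q b r] e by blast
      then show False using \<open>E y b\<close> irrefl by blast
    qed
  qed
qed

text \<open>If this failed, \<open>x, m, y, z\<close> would be the unique shortest walk between its
  ends. The hypotheses then produce one pentagon after another around it, until a local geodesic of
  four edges is undercut by a walk of three.\<close>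

lemma same_block_trans_path:
  assumes e: "E x m" "E m y" "E y z" and D: "same_block x y" "same_block m z"
  shows "same_block x z"
proof (rule ccontr)
  assume nD: "\<not> same_block x z"
  then have nN: "\<not> N1 x z" using same_block_near1 by blast
  have "x \<noteq> y" "m \<noteq> z" using nD e same_block_edge by blast+
  have nxy: "\<not> N1 x y"
  proof
    assume "N1 x y"
    then have "E x y" using \<open>x \<noteq> y\<close> by (simp add: near1_def)
    then show False
      using same_block_trans_neighbours[of y x m z] e D nD sym same_block_edge by blast
  qed
  have nmz: "\<not> N1 m z"
  proof
    assume "N1 m z"
    then have "E m z" using \<open>m \<noteq> z\<close> by (simp add: near1_def)
    then show False
      using same_block_trans_neighbours[of m x y z] e D nD sym same_block_edge by blast
  qed
  have n2: "\<not> N2 x z"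
    using pentagonI[OF e nxy nmz] nD pentagon_D by metis
  have uniq: "a = m \<and> b = y" if "E x a" "E a b" "E b z" for a b
    using geodesic3_unique[OF e that n2] by blast
  \<comment> \<open>Such a \<open>q\<close> would start a different walk of at most three edges from
    \<open>x\<close> to \<open>z\<close>.\<close>
  have no2: "\<not> N2 q z" if q: "E x q" "q \<noteq> m" for q
  proof
    assume "N2 q z"
    then consider "q = z" | "E q z" | b where "E q b" "E b z"
      unfolding near2_def near1_def by blast
    then show False
    proof cases
      case 1 then show False using q nN by (simp add: near1_def)
    next
      case 2 then show False using q n2 by (auto simp: near2_def)
    next
      case 3 then show False using uniq q by blast
    qed
  qed
  obtain p q where P0: "pentagon x m y p q" using same_block_pentagonE[OF D(1) nxy e(1,2)] by blast
  have "q \<noteq> m" using P0 unfolding pentagon_def near1_def using irrefl by blast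
  have q2: "\<not> N2 q z" using no2 P0 sym \<open>q \<noteq> m\<close> unfolding pentagon_def by blast
  have "same_block p m" by (rule pentagon_D[OF P0])
  then have "same_block p z"
    using same_block_trans_neighbours[of y p m z] P0 e D sym unfolding pentagon_def by blast
  have "\<not> N1 p z"
    using q2 P0 sym unfolding pentagon_def near2_def near1_def by blast
  then obtain t w where P4: "pentagon p y z t w"
    using same_block_pentagonE[OF \<open>same_block p z\<close>] P0 sym e unfolding pentagon_def by blast
  \<comment> \<open>Otherwise \<open>x, m, y, z, t\<close> is a local geodesic, but
    \<open>x, q, p, w, t\<close> also has four edges.\<close>
  have "N2 m t"
  proof (rule ccontr)
    assume "\<not> N2 m t"
    then have "m = q"
      using geodesic4_unique[of x m y z t q p w] e n2 P0 P4 sym unfolding pentagon_def by blast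
    then show False using \<open>q \<noteq> m\<close> by blast
  qed
  then obtain s where P2: "pentagon m y z t s"
    using pentagonI[of m y z t] e nmz P4 unfolding pentagon_def by blast
  have "same_block s x"
  proof -
    have "same_block y s" by (rule pentagon_D[OF P2])
    then show ?thesis
      using same_block_trans_neighbours[of m s y x] P2 e D sym same_block_sym unfolding pentagon_def by blast
  qed
  have nxs: "\<not> N1 x s"
  proof
    assume "N1 x s"
    then consider "x = s" | "E x s" by (auto simp: near1_def)
    then show False
    proof cases
      case 1
      then show False using P2 n2 sym unfolding pentagon_def near2_def by blast
    next
      case 2
      then have "s = m" using uniq[of s t] P2 sym unfolding pentagon_def by blast
      then show False using P2 irrefl unfolding pentagon_def by blast
    qed
  qed
  obtain w' q' where P3: "pentagon x m s w' q'"
    using same_block_pentagonE[of x s m] same_block_sym[OF \<open>same_block s x\<close>] nxs e P2 sym unfolding pentagon_def by blast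
  have q': "E x q'" "q' \<noteq> m"
    using P3 sym irrefl unfolding pentagon_def near1_def by blast+
  have q'2: "\<not> N2 q' z" by (rule no2[OF q'])
  have c: "E q' w'" "E w' s" "E s t" "E t z" "\<not> N1 q' m" "\<not> N1 m w'" "y \<noteq> t" "s \<noteq> y"
    using P2 P3 sym near1_sym unfolding pentagon_def near1_def by blast+
  \<comment> \<open>The same argument with \<open>q', x, m, y, z\<close> against
    \<open>q', w', s, t, z\<close>.\<close>
  have "N2 q' y"
  proof (rule ccontr)
    assume "\<not> N2 q' y"
    then show False
      using geodesic4_unique[of q' x m y z w' s t] q'(1) sym e n2 c by blast
  qed
  then obtain p' where "pentagon q' x m y p'"
    using pentagonI[of q' x m y] q'(1) sym e(1,2) c nxy by blast
  then have p': "E q' p'" "E p' y" using sym unfolding pentagon_def by blast+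
  have uniq': "a = p' \<and> b = y" if "E q' a" "E a b" "E b z" for a b
    using geodesic3_unique[OF p' e(3) that q'2] by blast
  have "\<not> N2 z w'"
  proof
    assume "N2 z w'"
    then consider "w' = z" | "E w' z" | g where "E w' g" "E g z"
      unfolding near2_def near1_def using sym by blast
    then show False
    proof cases
      case 3
      then have "E w' y" using uniq' c p' by blast
      then show False using midpoint_unique[of m s w' y] c e sym P2 unfolding pentagon_def by blast
    qed (use c q'2 in \<open>auto simp: near2_def near1_def\<close>)
  qed
  moreover have "\<not> N2 t q'"
  proof
    assume "N2 t q'"
    then consider "q' = t" | "E q' t" | g where "E q' g" "E g t"
      unfolding near2_def near1_def using sym by blast
    then show False
    proof cases
      case 3
      then show False using uniq' c by blast
    qed (use c q'2 in \<open>auto simp: near2_def near1_def\<close>)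
  qed
  \<comment> \<open>Now \<open>z, t, s, w', q'\<close> is a local geodesic of four edges, while
    \<open>z, y, p', q'\<close> has three.\<close>
  ultimately show False
    using geodesic4_not3[of z t s w' q' y p'] c p' e sym by blast
qed

section \<open>First vertices on geodesics of length at most two, and reduction to
  neighbours\<close>

definition dir where
  "dir u x m \<longleftrightarrow> E u m \<and> (m = x \<or> \<not> N1 u x \<and> E m x)"

lemma dir_exists:
  assumes "same_block u x" "u \<noteq> x"
  obtains m where "dir u x m"
  using assms same_block_midpointE[of u x] unfolding dir_def near1_def by metis

text \<open>Whether two vertices sharing a block with \<open>u\<close> share a block with each other
  can be read off at neighbours of \<open>u\<close>. One endpoint is replaced at a time, by
  \<open>same_block_trans_path\<close> along \<open>x, m, u, n\<close>.\<close>

lemma dir_D: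
  assumes "same_block u x" "same_block u y" "dir u x m" "dir u y n" "same_block m n"
  shows "same_block x y"
proof -
  have half: "same_block x n"
    if h: "same_block u x" "dir u x m" "dir u y n" "same_block m n" for x m y n
  proof (cases "m = x")
    case True then show ?thesis using that by simp
  next
    case False
    then have "E x m" "E m u" "E u n" using that sym unfolding dir_def by blast+
    then show ?thesis using same_block_trans_path same_block_sym that by blast
  qed
  have xn: "same_block x n" using half assms by blast
  have my: "same_block m y" using half[of y n x m] assms same_block_sym by blast
  consider "m = x" | "n = y" | "m = n" "m \<noteq> x" "n \<noteq> y" | "x = n" "n \<noteq> y"
    | "E x n" "m \<noteq> x" "n \<noteq> y" | "\<not> N1 x n" "m \<noteq> x" "n \<noteq> y"
    unfolding near1_def by blast
  then show ?thesis
  proof cases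
    case 1 then show ?thesis using my by simp
  next
    case 2 then show ?thesis using xn by simp
  next
    case 3
    then have "E m x" "E m u" "E m y" using assms sym unfolding dir_def by blast+
    then show ?thesis using same_block_trans_neighbours[of m x u y] assms same_block_sym by blast
  next
    case 4 then show ?thesis using assms same_block_edge unfolding dir_def by blast
  next
    case 5
    then have "E n x" "E n u" "E n y" using assms sym unfolding dir_def by blast+
    then show ?thesis using same_block_trans_neighbours[of n x u y] assms same_block_sym by blast
  next
    case 6
    have e: "E u n" "E n y" "\<not> N1 u x" "\<not> N1 n x"
      using 6 assms near1_sym unfolding dir_def by blast+
    obtain k where k: "E x k" "E k n" using same_block_midpointE[OF xn] 6 by blast
    \<comment> \<open>Once the midpoint \<open>k\<close> of \<open>x\<close> and \<open>n\<close>
      shares a block with \<open>u\<close>, it also does with \<open>y\<close>, and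
      \<open>same_block_trans_path\<close> applies to the walk \<open>x, k, n, y\<close>.\<close>
    have "same_block k u"
    proof (cases "N1 u k")
      case True
      then show ?thesis using same_block_near1 same_block_sym by blast
    next
      case False
      then obtain q where "pentagon u n k x q"
        using pentagonI[of u n k x] e k sym same_block_near2[OF assms(1)] by blast
      then show ?thesis by (rule pentagon_D)
    qed
    then have "same_block k y" using same_block_trans_neighbours[of n k u y] e k sym assms by blast
    then show ?thesis using same_block_trans_path[OF k(1,2) e(2) xn] by blast
  qed
qed

text \<open>Blocks are convex. In the main case \<open>y\<close> has distance two from both ends,
  with midpoints \<open>p\<close> towards \<open>u\<close> and \<open>q\<close> towards
  \<open>x\<close>; a failure would make \<open>m, u, p, y\<close> geodesic, while
  \<open>m, x, q, y\<close> is another walk of three edges.\<close>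

lemma same_block_midpoint:
  assumes D: "same_block y u" "same_block y x" "same_block u x" and m: "E u m" "E m x" "\<not> N1 u x"
  shows "same_block y m"
proof -
  have half: "same_block y m"
    if h: "E u m" "E m x" "\<not> N1 u x" "E y u" "same_block y x" "same_block u x" for u x
  proof (cases "N1 y x")
    case True
    then consider "y = x" | "E y x" by (auto simp: near1_def)
    then show ?thesis
    proof cases
      case 1 then show ?thesis using h sym same_block_edge by blast
    next
      case 2 then show ?thesis using midpoint_unique[of u m x y] h sym same_block_refl by blast
    qed
  next
    case False
    then obtain k where k: "E y k" "E k x" using h same_block_midpointE by blast
    show ?thesis
    proof (cases "N1 y m \<or> N1 u k")
      case True
      then show ?thesis
        using midpoint_unique[of u m x k] h k sym irrefl same_block_near1 same_block_edge unfolding near1_def by metis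
    next
      case n: False
      then have "\<not> N1 m y" "N2 m k"
        using near1_sym h k sym unfolding near2_def by blast+
      then obtain q where "pentagon m u y k q"
        using pentagonI[of m u y k] n h k sym by blast
      then show ?thesis by (rule pentagon_D)
    qed
  qed
  consider "y = u" | "y = x" | "E y u" | "E y x" | "\<not> N1 y u" "\<not> N1 y x"
    by (auto simp: near1_def)
  then show ?thesis
  proof cases
    case 1 then show ?thesis using m same_block_edge by blast
  next
    case 2 then show ?thesis using m same_block_edge sym by blast
  next
    case 3 then show ?thesis using half assms by blast
  next
    case 4 then show ?thesis using half[of x u] assms sym same_block_sym near1_sym by blast
  next
    case 5
    obtain p q where pq: "E y p" "E p u" "E y q" "E q x"
      using 5 D same_block_midpointE by metis
    show ?thesis
    proof (rule ccontr)
      assume n: "\<not> same_block y m"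
      have npm: "\<not> same_block p m" using same_block_trans_path[of y p u m] pq m D n by blast
      have "\<not> same_block m p" "E u p" "E p y" "\<not> N1 u y"
        using npm same_block_sym 5 near1_sym pq sym by blast+
      moreover have "E m u" using m sym by blast
      ultimately have "\<not> N2 m y" using not_D_near2 by blast
      then have "u = x"
        using geodesic3_unique[OF \<open>E m u\<close> \<open>E u p\<close> \<open>E p y\<close> m(2), of q] pq sym by blast
      then show False using m by (simp add: near1_def)
    qed
  qed
qed

text \<open>Converse of \<open>dir_D\<close>, by convexity applied at each of the two ends.\<close>

lemma same_block_dir:
  assumes "same_block u x" "same_block u y" "same_block x y" "dir u x m" "dir u y n"
  shows "same_block m n"
proof -
  have "same_block y m"
  proof (cases "m = x")
    case True then show ?thesis using assms same_block_sym by blast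
  next
    case False
    then show ?thesis using assms same_block_midpoint[of y u x m] same_block_sym unfolding dir_def by blast
  qed
  show ?thesis
  proof (cases "n = y")
    case True then show ?thesis using \<open>same_block y m\<close> same_block_sym by blast
  next
    case False
    then show ?thesis
      using \<open>same_block y m\<close> same_block_midpoint[of m u y n] assms same_block_sym same_block_edge unfolding dir_def by blast
  qed
qed

lemma dir_E: "dir u x m \<Longrightarrow> E u m"
  by (simp add: dir_def)

text \<open>Pass to first steps from \<open>u\<close>, use transitivity among neighbours, and return
  by \<open>dir_D\<close>. The case \<open>b = u\<close> is excluded because \<open>u\<close> may be
  a cut vertex lying in several blocks.\<close>

lemma same_block_trans_at:
  assumes "same_block u a" "same_block u b" "same_block u c" "same_block a b" "same_block b c" "b \<noteq> u"
  shows "same_block a c"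
proof (cases "a = u \<or> c = u")
  case True then show ?thesis using assms same_block_sym by blast
next
  case False
  obtain l m n where d: "dir u a l" "dir u b m" "dir u c n"
    using assms False dir_exists by metis
  have "same_block l m" "same_block m n" using same_block_dir assms d by blast+
  then have "same_block l n" using same_block_trans_neighbours[of u l m n] d dir_E by blast
  then show ?thesis using dir_D assms d by blast
qed

section \<open>Walks that pass to a new block at every inner vertex\<close>

fun same_block_path :: "'v list \<Rightarrow> bool" where
  "same_block_path (x # y # z # zs) = (x \<noteq> y \<and> same_block x y \<and> \<not> same_block x z \<and> same_block_path (y # z # zs))"
| "same_block_path [x, y] = (x \<noteq> y \<and> same_block x y)"
| "same_block_path _ = False"

lemma local_geodesic_Cons:
  assumes "local_geodesic E (y # z # zs)" "E x y" "\<not> same_block x z"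
  shows "local_geodesic E (x # y # z # zs)"
proof (cases zs)
  case Nil
  then show ?thesis using assms same_block_near1 by auto
next
  case (Cons w ws)
  then have "E y z" "E z w" "\<not> N1 y w"
    using local_geodesicD[of E y z "w # ws"] local_geodesicD[of E z w ws] assms(1) by auto
  moreover have "\<not> N2 x w" using not_D_near2[OF assms(3,2)] calculation by blast
  ultimately show ?thesis using assms same_block_near1 Cons by auto
qed

text \<open>A step of length two is expanded through its midpoint. The induction records the first
  edge of the expansion, because by \<open>dir_D\<close> the neighbours of \<open>y\<close> through
  which the walk arrives and leaves lie in different blocks.\<close>

lemma same_block_path_local_geodesic:
  assumes "same_block_path (x # y # zs)"
  shows "\<exists>m ws. dir x y m \<and> local_geodesic E (x # m # ws) \<and> last (m # ws) = last (y # zs)"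
  using assms
proof (induction zs arbitrary: x y)
  case Nil
  then have xy: "x \<noteq> y" "same_block x y" by auto
  then obtain m where m: "dir x y m" using dir_exists by blast
  show ?case
  proof (cases "m = y")
    case True
    then show ?thesis using m dir_E by (intro exI[of _ m] exI[of _ "[]"]) auto
  next
    case False
    then show ?thesis
      using m unfolding dir_def by (intro exI[of _ m] exI[of _ "[y]"]) (auto simp: dir_def)
  qed
next
  case (Cons z zs)
  then have xy: "x \<noteq> y" "same_block x y" "\<not> same_block x z" and p: "same_block_path (y # z # zs)" by auto
  then have yz: "same_block y z" by (cases zs) auto
  obtain n ws where n: "dir y z n" "local_geodesic E (y # n # ws)" "last (n # ws) = last (z # zs)"
    using Cons.IH[OF p] by blast
  obtain m where m: "dir x y m" using dir_exists xy by blast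
  show ?case
  proof (cases "m = y")
    case True
    have "dir y x x" using m True sym by (auto simp: dir_def)
    then have "\<not> same_block x n" using dir_D[of y x z x n] n xy yz same_block_sym by blast
    then have "local_geodesic E (x # y # n # ws)"
      using local_geodesic_Cons n m True dir_E by blast
    then show ?thesis
      using m n True by (intro exI[of _ m] exI[of _ "n # ws"]) auto
  next
    case False
    have e: "E x m" "E m y" "\<not> N1 x y" using m False by (auto simp: dir_def)
    then have "dir y x m" using sym near1_sym by (auto simp: dir_def)
    then have mn: "\<not> same_block m n" using dir_D[of y x z m n] n xy yz same_block_sym by blast
    have g: "local_geodesic E (m # y # n # ws)"
      using local_geodesic_Cons n e mn by blast
    have "E y n" using n dir_E by blast
    have "\<not> N2 x n"
      using pentagonI[of x m y n] e \<open>E y n\<close> mn same_block_near1 pentagon_D(2) by metis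
    then have "local_geodesic E (x # m # y # n # ws)"
      using g e near2_sym by auto
    then show ?thesis
      using m n by (intro exI[of _ m] exI[of _ "y # n # ws"]) auto
  qed
qed

lemma local_geodesic_endpoints:
  assumes "local_geodesic E (x # y # zs)"
  shows "last (y # zs) \<noteq> x"
  using local_geodesic_unique[OF assms, of "[x]"] by auto

lemma same_block_path_endpoints:
  assumes "same_block_path (x # y # zs)"
  shows "last (y # zs) \<noteq> x"
  using same_block_path_local_geodesic[OF assms] local_geodesic_endpoints by metis

end

section \<open>Groups with a finite block structure\<close>

text \<open>In the application \<open>inv a \<otimes> b \<in> insert \<one> A\<close> says that
  \<open>a\<close> and \<open>b\<close> share a block. The middle element of
  \<open>block_trans\<close> lies in \<open>A\<close>, hence differs from the base vertex
  \<open>\<one>\<close>, as \<open>same_block_trans_at\<close> demands.\<close>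

locale block_group = group G for G (structure) +
  fixes A :: "'a set"
  assumes A_closed: "A \<subseteq> carrier G"
    and finite_A: "finite A"
    and one_notin_A: "\<one> \<notin> A"
    and inv_A: "a \<in> A \<Longrightarrow> inv a \<in> A"
    and generate_A: "generate G A = carrier G"
    and block_trans: "\<lbrakk>a \<in> A; b \<in> A; c \<in> A; inv a \<otimes> b \<in> insert \<one> A; inv b \<otimes> c \<in> insert \<one> A\<rbrakk>
          \<Longrightarrow> inv a \<otimes> c \<in> insert \<one> A"
    and reduced_nontrivial: "\<lbrakk>as \<noteq> []; set as \<subseteq> A; successively (\<lambda>a b. a \<otimes> b \<notin> insert \<one> A) as\<rbrakk>
          \<Longrightarrow> foldr (\<otimes>) as \<one> \<noteq> \<one>"
begin

section \<open>Blocks through the identity, with the identity itself removed\<close>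

definition block :: "'a \<Rightarrow> 'a set" where
  "block a = {b \<in> A. inv a \<otimes> b \<in> insert \<one> A}"

lemma A_carrier: "a \<in> A \<Longrightarrow> a \<in> carrier G"
  using A_closed by blast

lemma block_rel_sym:
  assumes "a \<in> A" "b \<in> A" "inv a \<otimes> b \<in> insert \<one> A"
  shows "inv b \<otimes> a \<in> insert \<one> A"
proof -
  have "inv (inv a \<otimes> b) = inv b \<otimes> a" using assms A_carrier by (simp add: inv_mult_group)
  then show ?thesis using assms(3) inv_A by force
qed

lemma block_eq_iff:
  assumes "a \<in> A" "b \<in> A"
  shows "block a = block b \<longleftrightarrow> inv a \<otimes> b \<in> insert \<one> A"
proof
  assume "block a = block b"
  moreover have "b \<in> block b" using assms A_carrier by (simp add: block_def)
  ultimately have "b \<in> block a" by simp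
  then show "inv a \<otimes> b \<in> insert \<one> A" by (simp add: block_def)
next
  assume r: "inv a \<otimes> b \<in> insert \<one> A"
  show "block a = block b"
    unfolding block_def using block_trans[OF assms(1,2) _ r]
      block_trans[OF assms(2,1) _ block_rel_sym[OF assms r]] by blast
qed

text \<open>A letter a joins the block of a to the block of its inverse, making the
  blocks at the identity the objects of a groupoid.\<close>
abbreviation src where "src a \<equiv> block a"
abbreviation tgt where "tgt a \<equiv> block (inv a)"

lemma composable_iff:
  assumes "a \<in> A" "b \<in> A"
  shows "tgt a = src b \<longleftrightarrow> a \<otimes> b \<in> insert \<one> A"
  using block_eq_iff[of "inv a" b] assms inv_A A_carrier by simp

text \<open>The equation \<open>inv a \<otimes> (a \<otimes> b) = b\<close> places the product in
  the block of \<open>a\<close>; the target is the same argument for inverses.\<close>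

lemma composite:
  assumes "a \<in> A" "b \<in> A" "tgt a = src b" "a \<otimes> b \<noteq> \<one>"
  shows "a \<otimes> b \<in> A" "src (a \<otimes> b) = src a" "tgt (a \<otimes> b) = tgt b"
proof -
  show ab: "a \<otimes> b \<in> A" using assms composable_iff by blast
  have c: "a \<in> carrier G" "b \<in> carrier G" using assms A_carrier by auto
  have "inv a \<otimes> (a \<otimes> b) = b" using c by (simp add: m_assoc[symmetric])
  then show "src (a \<otimes> b) = src a" using block_eq_iff[of a "a \<otimes> b"] ab assms by simp
  have "inv (inv b) \<otimes> inv (a \<otimes> b) = inv a"
    using c by (simp add: inv_mult_group m_assoc[symmetric])
  then show "tgt (a \<otimes> b) = tgt b"
    using block_eq_iff[of "inv b" "inv (a \<otimes> b)"] ab assms inv_A by simp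
qed

text \<open>The one group element \<open>\<one>\<close> serves as identity arrow at every object. It
  is not in \<open>A\<close>, so exactly the nontrivial arrows determine their ends.\<close>

definition Hom :: "'a set \<Rightarrow> 'a set \<Rightarrow> 'a set" where
  "Hom c d = {a. a \<in> A \<and> src a = c \<and> tgt a = d \<or> c = d \<and> a = \<one>}"

lemma Hom_carrier: "a \<in> Hom c d \<Longrightarrow> a \<in> carrier G"
  unfolding Hom_def using A_carrier by blast

lemma Hom_one: "\<one> \<in> Hom c c"
  unfolding Hom_def by blast

lemma Hom_inv: "a \<in> Hom c d \<Longrightarrow> inv a \<in> Hom d c"
  unfolding Hom_def using inv_A A_carrier by auto

lemma Hom_nontrivial: "a \<in> Hom c d \<Longrightarrow> a \<noteq> \<one> \<Longrightarrow> a \<in> A \<and> src a = c \<and> tgt a = d"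
  unfolding Hom_def by blast

lemma Hom_offdiag: "a \<in> Hom c d \<Longrightarrow> c \<noteq> d \<Longrightarrow> a \<in> A \<and> src a = c \<and> tgt a = d"
  unfolding Hom_def by blast

lemma Hom_self: "a \<in> A \<Longrightarrow> a \<in> Hom (src a) (tgt a)"
  unfolding Hom_def by blast

lemma Hom_mult:
  assumes a: "a \<in> Hom c d" and b: "b \<in> Hom d e"
  shows "a \<otimes> b \<in> Hom c e"
proof (cases "a = \<one> \<or> b = \<one>")
  case True
  then show ?thesis using a b Hom_carrier[OF a] Hom_carrier[OF b] unfolding Hom_def using one_notin_A by auto
next
  case False
  then have ab: "a \<in> A" "src a = c" "tgt a = d" "b \<in> A" "src b = d" "tgt b = e"
    using Hom_nontrivial a b by blast+
  show ?thesis
  proof (cases "a \<otimes> b = \<one>")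
    case True
    then have "inv a = b" using ab A_carrier inv_equality by (metis inv_inv inv_closed)
    then have "c = e" using ab A_carrier by auto
    then show ?thesis using True Hom_one by simp
  next
    case False
    then show ?thesis using composite[of a b] ab unfolding Hom_def by auto
  qed
qed

definition blocks :: "'a set set" where
  "blocks = block ` A"

definition linked where
  "linked c d \<longleftrightarrow> Hom c d \<noteq> {}"

lemma linked_equiv: "linked c c" "linked c d \<Longrightarrow> linked d c" "linked c d \<Longrightarrow> linked d e \<Longrightarrow> linked c e"
  unfolding linked_def using Hom_one Hom_inv Hom_mult by blast+

text \<open>The choice depends on the predicate \<open>linked c\<close> alone, which is the same for
  all objects of a component; this gives \<open>root_cong\<close>.\<close>

definition root where
  "root c = (SOME d. linked c d)"

lemma linked_root: "linked c (root c)"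
  unfolding root_def by (rule someI[of _ c]) (rule linked_equiv)

lemma root_cong: "linked c d \<Longrightarrow> root c = root d"
proof -
  assume "linked c d"
  then have "linked c = linked d" using linked_equiv by blast
  then show ?thesis unfolding root_def by simp
qed

lemma root_root: "root (root c) = root c"
  using root_cong[OF linked_root] by simp

lemma linked_blocks: "linked c d \<Longrightarrow> c \<in> blocks \<Longrightarrow> d \<in> blocks"
  unfolding linked_def Hom_def blocks_def using inv_A by auto

lemma root_blocks: "c \<in> blocks \<Longrightarrow> root c \<in> blocks"
  using linked_blocks linked_root by blast

text \<open>A spanning star of each component. The value \<open>\<one>\<close> at the root lets
  expressions such as \<open>h \<otimes> arrow d\<close> cover the root as well.\<close>

definition arrow where
  "arrow c = (if root c = c then \<one> else SOME a. a \<in> Hom (root c) c)"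

lemma arrow_Hom: "arrow c \<in> Hom (root c) c"
proof (cases "root c = c")
  case True
  then show ?thesis using Hom_one[of c] by (simp add: arrow_def)
next
  case False
  have "\<exists>a. a \<in> Hom (root c) c"
    using linked_equiv(2)[OF linked_root[of c]] unfolding linked_def by blast
  then show ?thesis using False someI_ex unfolding arrow_def by simp
qed

lemma arrow_nonroot:
  assumes "root c \<noteq> c"
  shows "arrow c \<in> A" "src (arrow c) = root c" "tgt (arrow c) = c"
    "inv (arrow c) \<in> A" "src (inv (arrow c)) = c" "tgt (inv (arrow c)) = root c"
  using Hom_offdiag[OF arrow_Hom assms] Hom_offdiag[OF Hom_inv[OF arrow_Hom] assms[symmetric]]
  by blast+

lemma arrow_carrier: "arrow c \<in> carrier G"
  using Hom_carrier[OF arrow_Hom] .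

text \<open>The universal group of a connected groupoid is the free product of a vertex group and
  the free group on the edges of a spanning tree, here a star. This yields one factor per
  object.\<close>

definition factor where
  "factor c = (if root c = c then Hom c c else generate G {arrow c})"

lemma subgroup_Hom: "subgroup (Hom c c) G"
  by (rule subgroupI) (use Hom_carrier Hom_one Hom_inv Hom_mult in blast)+

lemma subgroup_factor: "subgroup (factor c) G"
  unfolding factor_def using subgroup_Hom generate_is_subgroup[of "{arrow c}"] arrow_carrier by simp

lemma factor_carrier: "h \<in> factor c \<Longrightarrow> h \<in> carrier G"
  using subgroup.mem_carrier[OF subgroup_factor] .

lemma arrow_generate:
  assumes "c \<in> blocks"
  shows "arrow c \<in> generate G (\<Union>c\<in>blocks. factor c)"
proof (cases "root c = c")
  case True
  then show ?thesis using generate.one by (simp add: arrow_def)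
next
  case False
  then have "arrow c \<in> factor c" using generate.incl[of "arrow c" "{arrow c}"] by (simp add: factor_def)
  then show ?thesis using assms by (blast intro: generate.incl)
qed

lemma generate_factors: "generate G (\<Union>c\<in>blocks. factor c) = carrier G"
proof -
  let ?U = "\<Union>c\<in>blocks. factor c"
  have U: "?U \<subseteq> carrier G" using factor_carrier by blast
  have sub: "subgroup (generate G ?U) G" by (rule generate_is_subgroup[OF U])
  have "a \<in> generate G ?U" if a: "a \<in> A" for a
  proof -
    let ?c = "src a" and ?d = "tgt a"
    have r: "root ?c = root ?d" using root_cong Hom_self[OF a] unfolding linked_def by blast
    have cd: "?c \<in> blocks" "?d \<in> blocks" using a inv_A unfolding blocks_def by auto
    \<comment> \<open>Closing up \<open>a\<close> with the chosen arrows gives a loop at the root,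
      from which \<open>a\<close> is recovered.\<close>
    let ?h = "arrow ?c \<otimes> a \<otimes> inv (arrow ?d)"
    have "?h \<in> Hom (root ?c) (root ?c)"
      using Hom_mult[OF Hom_mult[OF arrow_Hom Hom_self[OF a]] Hom_inv[OF arrow_Hom]] r by simp
    then have "?h \<in> factor (root ?c)" by (simp add: factor_def root_root)
    then have h: "?h \<in> generate G ?U" using root_blocks[OF cd(1)] by (blast intro: generate.incl)
    have "inv (arrow ?c) \<otimes> ?h \<otimes> arrow ?d \<in> generate G ?U"
      by (intro subgroup.m_closed[OF sub] subgroup.m_inv_closed[OF sub] h arrow_generate cd)
    moreover have "inv (arrow ?c) \<otimes> ?h \<otimes> arrow ?d = a"
    proof -
      let ?p = "arrow ?c" and ?q = "arrow ?d"
      have c: "?p \<in> carrier G" "?q \<in> carrier G" "a \<in> carrier G"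
        using arrow_carrier A_carrier[OF a] by auto
      have "inv ?p \<otimes> ?h \<otimes> ?q = inv ?p \<otimes> (?p \<otimes> a \<otimes> (inv ?q \<otimes> ?q))"
        using c by (simp add: m_assoc del: l_inv)
      also have "\<dots> = inv ?p \<otimes> ?p \<otimes> a" using c by (simp add: m_assoc[symmetric] del: l_inv)
      finally show ?thesis using c by simp
    qed
    ultimately show ?thesis by simp
  qed
  then have "generate G A \<subseteq> generate G ?U"
    using generate_subgroup_incl[OF _ sub] by blast
  then show ?thesis using generate_A generate_incl[OF U] by blast
qed

section \<open>Reduced words and the first letter of a product\<close>

definition reduced where
  "reduced as \<longleftrightarrow> as \<noteq> [] \<and> set as \<subseteq> A \<and> successively (\<lambda>a b. tgt a \<noteq> src b) as"

text \<open>Multiplication from the left interacts only with the first letter of a reduced form, so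
  a predicate on that letter can serve as the induction invariant.\<close>

definition starts :: "('a \<Rightarrow> bool) \<Rightarrow> 'a \<Rightarrow> bool" where
  "starts P g \<longleftrightarrow> (\<exists>a as. reduced (a # as) \<and> P a \<and> g = foldr (\<otimes>) (a # as) \<one>)"

lemma foldr_carrier: "set as \<subseteq> A \<Longrightarrow> foldr (\<otimes>) as \<one> \<in> carrier G"
  by (induction as) (auto intro: A_carrier)

lemma starts_carrier: "starts P g \<Longrightarrow> g \<in> carrier G"
  unfolding starts_def reduced_def using foldr_carrier by blast

lemma starts_nontrivial:
  assumes "starts P g"
  shows "g \<noteq> \<one>"
proof -
  obtain as where as: "reduced as" "g = foldr (\<otimes>) as \<one>" using assms unfolding starts_def by blast
  have "a \<otimes> b \<notin> insert \<one> A" if "a \<in> set as" "b \<in> set as" "tgt a \<noteq> src b" for a b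
    using that as(1) composable_iff[of a b] unfolding reduced_def by blast
  moreover have "successively (\<lambda>a b. tgt a \<noteq> src b) as" using as(1) unfolding reduced_def by blast
  ultimately have "successively (\<lambda>a b. a \<otimes> b \<notin> insert \<one> A) as"
    by (rule successively_mono[rotated])
  moreover have "as \<noteq> []" "set as \<subseteq> A" using as(1) unfolding reduced_def by blast+
  ultimately show ?thesis using reduced_nontrivial[of as] as(2) by simp
qed

lemma starts_single: "a \<in> A \<Longrightarrow> P a \<Longrightarrow> starts P a"
  unfolding starts_def reduced_def using A_carrier by (intro exI[of _ a] exI[of _ "[]"]) simp

text \<open>Either \<open>b\<close> is put in front, or it merges with \<open>a\<close> into one
  letter with the target of \<open>a\<close>. The rest of the word then stays reduced, so a merge
  does not propagate.\<close>

lemma starts_mult: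
  assumes "starts P g" "b \<in> A"
    and "\<And>a. a \<in> A \<Longrightarrow> P a \<Longrightarrow> tgt b \<noteq> src a \<Longrightarrow> Q b"
    and "\<And>a. a \<in> A \<Longrightarrow> P a \<Longrightarrow> tgt b = src a \<Longrightarrow> b \<otimes> a \<noteq> \<one> \<and> Q (b \<otimes> a)"
  shows "starts Q (b \<otimes> g)"
proof -
  obtain a as where a: "reduced (a # as)" "P a" "g = foldr (\<otimes>) (a # as) \<one>"
    using assms(1) unfolding starts_def by blast
  have aA: "a \<in> A" "set as \<subseteq> A" using a(1) by (auto simp: reduced_def)
  show ?thesis
  proof (cases "tgt b = src a")
    case False
    then have "reduced (b # a # as)" using a(1) assms(2) by (simp add: reduced_def)
    then show ?thesis
      unfolding starts_def using a False assms(3) aA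
      by (intro exI[of _ b] exI[of _ "a # as"]) simp
  next
    case True
    note n = assms(4)[OF aA(1) a(2) True]
    have "reduced ((b \<otimes> a) # as)"
      using a(1) composite[OF assms(2) aA(1) True] n by (simp add: reduced_def successively_Cons)
    moreover have "b \<otimes> g = foldr (\<otimes>) ((b \<otimes> a) # as) \<one>"
      using a(3) aA assms(2) A_carrier foldr_carrier by (simp add: m_assoc)
    ultimately show ?thesis unfolding starts_def using n by blast
  qed
qed

text \<open>What is known about the first letter of the reduced form of a product of
  syllables whose first syllable lies in the factor of c.\<close>
definition first_in :: "'a set \<Rightarrow> 'a \<Rightarrow> bool" where
  "first_in c a \<longleftrightarrow>
     (if root c = c then \<exists>d h. root d = c \<and> h \<in> Hom c c \<and> h \<noteq> \<one> \<and> a = h \<otimes> arrow d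
      else a = arrow c \<or> src a = c)"

lemma first_in_src:
  assumes "a \<in> A" "first_in c a" "root c = c"
  shows "src a = c"
proof -
  obtain d h where h: "root d = c" "h \<in> Hom c c" "a = h \<otimes> arrow d"
    using assms unfolding first_in_def by auto
  then have "a \<in> Hom c d" using Hom_mult arrow_Hom by blast
  then show ?thesis using assms(1) Hom_nontrivial one_notin_A by metis
qed

text \<open>The loop \<open>h\<close> can merge only with a letter that starts at \<open>c\<close>.
  By \<open>first_in c'\<close> that letter is \<open>arrow c'\<close>, and the product still joins
  two different objects, hence is not \<open>\<one>\<close>.\<close>

lemma starts_root:
  assumes c: "root c = c" and h: "h \<in> Hom c c" "h \<noteq> \<one>"
    and g: "starts (first_in c') g" "c' \<noteq> c"
  shows "starts (first_in c) (h \<otimes> g)"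
proof (rule starts_mult[OF g(1)])
  have hA: "h \<in> A" "src h = c" "tgt h = c" using Hom_nontrivial h by blast+
  show "h \<in> A" by fact
  show "first_in c h"
    unfolding first_in_def using c h Hom_carrier[OF h(1)]
    by (auto simp: arrow_def intro!: exI[of _ c] exI[of _ h])
  fix a assume a: "a \<in> A" "first_in c' a" "tgt h = src a"
  have c': "root c' \<noteq> c'" using first_in_src[OF a(1,2)] a(3) hA g(2) by auto
  then have "src a \<noteq> c'" using a hA g by auto
  then have "a = arrow c'" using a c' unfolding first_in_def by auto
  then have r: "root c' = c" using arrow_nonroot[OF c'] a hA by simp
  have m: "h \<otimes> a \<in> Hom c c'"
    using Hom_mult[OF h(1)] arrow_Hom[of c'] r \<open>a = arrow c'\<close> by simp
  have "h \<otimes> a \<noteq> \<one>"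
    using Hom_offdiag[OF m] g(2) one_notin_A by metis
  moreover have "first_in c (h \<otimes> a)"
    unfolding first_in_def using c r h \<open>a = arrow c'\<close> by auto
  ultimately show "h \<otimes> a \<noteq> \<one> \<and> first_in c (h \<otimes> a)" by blast
qed

lemma starts_arrow:
  assumes c: "root c \<noteq> c" and g: "starts (\<lambda>a. src a \<noteq> c) g"
  shows "starts (\<lambda>a. a = arrow c) (arrow c \<otimes> g)"
  by (rule starts_mult[OF g]) (use arrow_nonroot[OF c] in auto)

text \<open>The inverse arrow ends at the root and may merge there with the first letter, but only
  \<open>arrow c\<close> would cancel it.\<close>

lemma starts_inv_arrow:
  assumes c: "root c \<noteq> c" and g: "starts (\<lambda>a. a \<noteq> arrow c) g"
  shows "starts (\<lambda>a. src a = c) (inv (arrow c) \<otimes> g)"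
proof (rule starts_mult[OF g])
  show "inv (arrow c) \<in> A" using arrow_nonroot[OF c] by blast
  fix a assume a: "a \<in> A" "a \<noteq> arrow c" "tgt (inv (arrow c)) = src a"
  have "inv (arrow c) \<otimes> a \<noteq> \<one>"
    using a arrow_carrier A_carrier by (metis inv_equality inv_closed inv_inv)
  then show "inv (arrow c) \<otimes> a \<noteq> \<one> \<and> src (inv (arrow c) \<otimes> a) = c"
    using composite[of "inv (arrow c)" a] a arrow_nonroot[OF c] by simp
qed (use arrow_nonroot[OF c] in auto)

lemma starts_mono:
  assumes "starts P g" "\<And>a. a \<in> A \<Longrightarrow> P a \<Longrightarrow> Q a"
  shows "starts Q g"
  using assms unfolding starts_def reduced_def by auto

text \<open>These are the two bad first letters for the factor of a non-root \<open>c\<close>: one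
  that merges with \<open>arrow c\<close>, one that cancels its inverse. An equality
  \<open>h \<otimes> arrow d = arrow c\<close> would force \<open>d = c\<close> by comparing
  targets, and then \<open>h = \<one>\<close>.\<close>

lemma first_in_other:
  assumes c: "root c \<noteq> c" "c' \<noteq> c" and a: "a \<in> A" "first_in c' a"
  shows "src a \<noteq> c" "a \<noteq> arrow c"
proof -
  note arr = arrow_nonroot
  show "src a \<noteq> c"
  proof (cases "root c' = c'")
    case True
    then show ?thesis using first_in_src a c by blast
  next
    case False
    then show ?thesis using arr[OF False] a c root_root unfolding first_in_def by metis
  qed
  show "a \<noteq> arrow c"
  proof
    assume eq: "a = arrow c"
    show False
    proof (cases "root c' = c'")
      case True
      then obtain d h where h: "root d = c'" "h \<in> Hom c' c'" "h \<noteq> \<one>" "a = h \<otimes> arrow d"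
        using a unfolding first_in_def by auto
      then have "a \<in> Hom c' d" using Hom_mult arrow_Hom by blast
      then have "d = c" using Hom_nontrivial a one_notin_A eq arr[OF c(1)] by metis
      then have "h \<otimes> arrow c = arrow c" using h eq by simp
      then show False using h Hom_carrier arrow_carrier by (metis r_cancel_one)
    next
      case False
      then show False
        using a(2) eq arr[OF False] arr[OF c(1)] c root_root unfolding first_in_def by metis
    qed
  qed
qed

definition avoids where
  "avoids c g \<longleftrightarrow> g = \<one> \<or> (\<exists>c'. c' \<noteq> c \<and> starts (first_in c') g)"

lemma starts_arrow_pow:
  assumes c: "root c \<noteq> c" and g: "avoids c g"
  shows "starts (\<lambda>a. a = arrow c) (arrow c [^] Suc n \<otimes> g)"
    and "starts (\<lambda>a. src a = c) (inv (arrow c) [^] Suc n \<otimes> g)"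
proof -
  note arr = arrow_nonroot[OF c]
  let ?x = "arrow c"
  have gc: "g \<in> carrier G" using g starts_carrier unfolding avoids_def by auto
  have x: "?x \<in> carrier G" by (rule arrow_carrier)
  have g1: "starts (\<lambda>a. src a \<noteq> c) g" "starts (\<lambda>a. a \<noteq> ?x) g" if nontriv: "g \<noteq> \<one>"
  proof -
    obtain c' where c': "c' \<noteq> c" "starts (first_in c') g" using nontriv g unfolding avoids_def by blast
    show "starts (\<lambda>a. src a \<noteq> c) g" "starts (\<lambda>a. a \<noteq> ?x) g"
      by (rule starts_mono[OF c'(2)], rule first_in_other[OF c c'(1)], assumption+)+
  qed
  have *: "starts (\<lambda>a. a = ?x) (?x \<otimes> g)" "starts (\<lambda>a. src a = c) (inv ?x \<otimes> g)"
    using starts_single[of ?x "\<lambda>a. a = ?x"] starts_single[of "inv ?x" "\<lambda>a. src a = c"]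
      starts_arrow[OF c] starts_inv_arrow[OF c] g1 arr x by (cases "g = \<one>"; simp)+
  show "starts (\<lambda>a. a = ?x) (?x [^] Suc n \<otimes> g)"
  proof (induction n)
    case 0
    then show ?case using * x by simp
  next
    case (Suc n)
    have "starts (\<lambda>a. src a \<noteq> c) (?x [^] Suc n \<otimes> g)"
      using starts_mono[OF Suc] arr c by auto
    from starts_arrow[OF c this] show ?case
      using x gc by (subst nat_pow_Suc2) (simp_all add: m_assoc)
  qed
  show "starts (\<lambda>a. src a = c) (inv ?x [^] Suc n \<otimes> g)"
  proof (induction n)
    case 0
    then show ?case using * x by simp
  next
    case (Suc n)
    have "starts (\<lambda>a. a \<noteq> ?x) (inv ?x [^] Suc n \<otimes> g)"
      by (rule starts_mono[OF Suc]) (use arr c in metis)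
    from starts_inv_arrow[OF c this] show ?case
      using x gc by (subst nat_pow_Suc2) (simp_all add: m_assoc)
  qed
qed

lemma starts_factor:
  assumes h: "h \<in> factor c" "h \<noteq> \<one>" and g: "avoids c g"
  shows "starts (first_in c) (h \<otimes> g)"
proof (cases "root c = c")
  case True
  then have hH: "h \<in> Hom c c" using h by (simp add: factor_def)
  show ?thesis
  proof (cases "g = \<one>")
    case g1: True
    have "first_in c h"
      unfolding first_in_def using True hH h Hom_carrier[OF hH]
      by (auto simp: arrow_def intro!: exI[of _ c] exI[of _ h])
    then show ?thesis
      using starts_single g1 Hom_nontrivial[OF hH h(2)] Hom_carrier[OF hH] by simp
  next
    case False
    then show ?thesis using starts_root[OF True hH h(2)] g unfolding avoids_def by blast
  qed
next
  case False
  let ?x = "arrow c"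
  have x: "?x \<in> carrier G" by (rule arrow_carrier)
  obtain k :: int where k: "h = ?x [^] k"
    using h False generate_pow[OF x] by (auto simp: factor_def)
  have "k \<noteq> 0" using k h by auto
  then consider n where "k = int (Suc n)" | n where "k = - int (Suc n)"
    by (metis int_cases3 gr0_implies_Suc of_nat_0_less_iff)
  then show ?thesis
  proof cases
    case 1
    then have "h = ?x [^] Suc n" using k int_pow_int by metis
    then show ?thesis
      using starts_mono[OF starts_arrow_pow(1)[OF False g]] False by (simp add: first_in_def)
  next
    case 2
    then have "h = inv ?x [^] Suc n" using k int_pow_neg_int x nat_pow_inv by metis
    then show ?thesis
      using starts_mono[OF starts_arrow_pow(2)[OF False g]] False by (simp add: first_in_def)
  qed
qed

lemma infinite_factor:
  assumes c: "root c \<noteq> c"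
  shows "infinite (factor c)"
proof -
  let ?x = "arrow c"
  have x: "?x \<in> carrier G" by (rule arrow_carrier)
  have n1: "?x [^] Suc n \<noteq> \<one>" for n
    using starts_nontrivial[OF starts_arrow_pow(1)[OF c, of \<one> n]] x by (simp add: avoids_def)
  have "inj (\<lambda>n::nat. ?x [^] n)"
  proof (rule linorder_inj_onI')
    fix i j :: nat assume "i < j"
    then obtain n where "j = i + Suc n" using less_imp_Suc_add by auto
    then have "?x [^] j = ?x [^] i \<otimes> ?x [^] Suc n" using x by (simp only: nat_pow_mult)
    then show "?x [^] i \<noteq> ?x [^] j" using n1[of n] x l_cancel_one'[of "?x [^] i" "?x [^] Suc n"] nat_pow_closed by metis
  qed
  moreover have "range (\<lambda>n::nat. ?x [^] n) \<subseteq> factor c"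
  proof
    fix h assume "h \<in> range (\<lambda>n::nat. ?x [^] n)"
    then obtain n :: nat where "h = ?x [^] int n" by (auto simp: int_pow_int)
    then show "h \<in> factor c" using c generate_pow[OF x] unfolding factor_def by auto
  qed
  ultimately show ?thesis using finite_subset finite_imageD by blast
qed

theorem plain: "plain_group G"
proof -
  have "finite blocks" by (simp add: blocks_def finite_A)
  then obtain f n where f: "bij_betw f {..<n::nat} blocks"
    using ex_bij_betw_nat_finite[of blocks] by (auto simp: atLeast0LessThan)
  let ?H = "\<lambda>i. factor (f i)"
  have inj: "f i \<noteq> f j" if "i < n" "j < n" "i \<noteq> j" for i j
    using that f by (auto simp: bij_betw_def inj_on_def)
  \<comment> \<open>Induction from the right: each new syllable meets a tail that is
    \<open>\<one>\<close> or begins in another factor.\<close>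
  have reduced: "starts (first_in (f (fst (hd ws)))) (foldr (\<lambda>p acc. snd p \<otimes> acc) ws \<one>)"
    if "ws \<noteq> []" "\<forall>(i, h) \<in> set ws. i < n \<and> h \<in> ?H i \<and> h \<noteq> \<one>"
       "successively (\<lambda>x y. fst x \<noteq> fst y) ws" for ws
    using that
  proof (induction ws)
    case (Cons p ws)
    obtain i h where p: "p = (i, h)" by fastforce
    have "avoids (f i) (foldr (\<lambda>p acc. snd p \<otimes> acc) ws \<one>)"
    proof (cases "ws = []")
      case True
      then show ?thesis by (simp add: avoids_def)
    next
      case False
      have "fst (hd ws) < n" "i < n" "fst (hd ws) \<noteq> i"
        using Cons.prems False p bspec[OF Cons.prems(2), of "hd ws"]
        by (auto simp: successively_Cons split_beta)
      moreover have "starts (first_in (f (fst (hd ws)))) (foldr (\<lambda>p acc. snd p \<otimes> acc) ws \<one>)"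
        using Cons False by (simp add: successively_Cons)
      ultimately show ?thesis unfolding avoids_def using inj by blast
    qed
    then show ?case using starts_factor Cons.prems p by simp
  qed simp
  have "free_product_of G n ?H"
    unfolding free_product_of_def
  proof (intro conjI allI impI)
    show "generate G (\<Union>i<n. ?H i) = carrier G"
      using generate_factors f by (metis bij_betw_imp_surj_on image_image)
  qed (use subgroup_factor starts_nontrivial reduced in blast)+
  moreover have "finite (?H i) \<or> infinite_cyclic_subgroup G (?H i)" for i
  proof (cases "root (f i) = f i")
    case True
    have "Hom (f i) (f i) \<subseteq> insert \<one> A" unfolding Hom_def by blast
    then show ?thesis using True finite_A finite_subset by (auto simp: factor_def)
  next
    case False
    then show ?thesis
      using infinite_factor[OF False] arrow_carrier unfolding infinite_cyclic_subgroup_def factor_def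
      by auto
  qed
  ultimately show ?thesis unfolding plain_group_def by blast
qed

end

section \<open>Normal forms of length-reducing systems\<close>

definition irreducible_word :: "('a list \<times> 'a list) set \<Rightarrow> 'a list \<Rightarrow> bool" where
  "irreducible_word T w \<longleftrightarrow> (\<forall>v. (w, v) \<notin> rstep T)"

lemma rstepI: "(l, r) \<in> T \<Longrightarrow> (u @ l @ v, u @ r @ v) \<in> rstep T"
  unfolding rstep_def by blast

lemma rule_rstep: "(l, r) \<in> T \<Longrightarrow> (l, r) \<in> rstep T"
  using rstepI[of l r T "[]" "[]"] by simp

lemma irreducible_word_subword:
  assumes "irreducible_word T (u @ w @ v)"
  shows "irreducible_word T w"
  unfolding irreducible_word_def
proof (intro allI notI)
  fix x assume "(w, x) \<in> rstep T"
  then obtain u' l r v' where "w = u' @ l @ v'" "(l, r) \<in> T" unfolding rstep_def by blast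
  then have "(u @ w @ v, (u @ u') @ r @ (v' @ v)) \<in> rstep T"
    using rstepI[of l r T "u @ u'" "v' @ v"] by simp
  then show False using assms unfolding irreducible_word_def by blast
qed

lemma rstep_length:
  assumes "length_reducing T" "(u, v) \<in> rstep T"
  shows "length v < length u"
proof -
  obtain x l r y where "u = x @ l @ y" "v = x @ r @ y" "(l, r) \<in> T"
    using assms(2) unfolding rstep_def by blast
  then show ?thesis using assms(1) unfolding length_reducing_def by fastforce
qed

text \<open>Stated in both directions because \<open>conv\<close> also rewrites backwards.\<close>

lemma rstep_lists:
  assumes "T \<subseteq> lists \<Sigma> \<times> lists \<Sigma>" "(u, v) \<in> rstep T"
  shows "u \<in> lists \<Sigma> \<longleftrightarrow> v \<in> lists \<Sigma>"
proof -
  obtain x l r y where "u = x @ l @ y" "v = x @ r @ y" "(l, r) \<in> T"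
    using assms(2) unfolding rstep_def by blast
  moreover have "l \<in> lists \<Sigma>" "r \<in> lists \<Sigma>" using assms(1) \<open>(l, r) \<in> T\<close> by auto
  ultimately show ?thesis by simp
qed

lemma rsteps_length:
  assumes "length_reducing T" "(u, v) \<in> (rstep T)\<^sup>*"
  shows "u = v \<or> length v < length u"
  using assms(2) by (induction rule: rtrancl_induct) (use rstep_length[OF assms(1)] in force)+

lemma rsteps_lists:
  assumes "T \<subseteq> lists \<Sigma> \<times> lists \<Sigma>" "(u, v) \<in> (rstep T)\<^sup>*" "u \<in> lists \<Sigma>"
  shows "v \<in> lists \<Sigma>"
  using assms(2,3) by (induction rule: rtrancl_induct) (use rstep_lists[OF assms(1)] in blast)+

lemma rsteps_conv: "(u, v) \<in> (rstep T)\<^sup>* \<Longrightarrow> (u, v) \<in> conv T"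
  unfolding conv_def using rtrancl_mono[of "rstep T" "rstep T \<union> (rstep T)\<inverse>"] by blast

lemma length_reducing_terminating:
  assumes "length_reducing T"
  shows "terminating \<Sigma> T"
  unfolding terminating_def
proof
  assume "\<exists>f. f 0 \<in> lists \<Sigma> \<and> (\<forall>i. (f i, f (Suc i)) \<in> rstep T)"
  then obtain f where "\<And>i. (f i, f (Suc i)) \<in> rstep T" by blast
  then have "length (f (Suc i)) < length (f i)" for i using rstep_length[OF assms] by blast
  then show False using wf_iff_no_infinite_down_chain[of "measure length"] by auto
qed

lemma normal_form_exists:
  assumes "length_reducing T"
  obtains z where "(w, z) \<in> (rstep T)\<^sup>*" "irreducible_word T z"
proof (induction "length w" arbitrary: w thesis rule: less_induct)
  case less
  show ?case
  proof (cases "irreducible_word T w")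
    case True
    then show ?thesis using less.prems by blast
  next
    case False
    then obtain v where v: "(w, v) \<in> rstep T" unfolding irreducible_word_def by blast
    obtain z where "(v, z) \<in> (rstep T)\<^sup>*" "irreducible_word T z"
      using less.hyps[OF rstep_length[OF assms v]] by blast
    then show ?thesis using less.prems v by (meson converse_rtrancl_into_rtrancl)
  qed
qed

lemma irreducible_rsteps: "irreducible_word T w \<Longrightarrow> (w, v) \<in> (rstep T)\<^sup>* \<Longrightarrow> v = w"
  unfolding irreducible_word_def by (metis converse_rtranclE)

text \<open>Confluence is available only for words over the alphabet, so membership is carried along
  the zigzag.\<close>

lemma church_rosser:
  assumes T: "T \<subseteq> lists \<Sigma> \<times> lists \<Sigma>" and c: "confluent \<Sigma> T"
    and "(u, v) \<in> conv T" "u \<in> lists \<Sigma>"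
  shows "v \<in> lists \<Sigma> \<and> (\<exists>z. (u, z) \<in> (rstep T)\<^sup>* \<and> (v, z) \<in> (rstep T)\<^sup>*)"
  using assms(3,4) unfolding conv_def
proof (induction rule: rtrancl_induct)
  case base
  then show ?case by blast
next
  case (step v v')
  then obtain z where z: "v \<in> lists \<Sigma>" "(u, z) \<in> (rstep T)\<^sup>*" "(v, z) \<in> (rstep T)\<^sup>*" by blast
  show ?case
  proof (cases "(v, v') \<in> rstep T")
    case True
    then have vv': "(v, v') \<in> (rstep T)\<^sup>*" by blast
    then obtain z' where "(z, z') \<in> (rstep T)\<^sup>*" "(v', z') \<in> (rstep T)\<^sup>*"
      using c z unfolding confluent_def by blast
    then show ?thesis using z rsteps_lists[OF T vv'] by (meson rtrancl_trans)
  next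
    case False
    then have s: "(v', v) \<in> rstep T" using step by blast
    then have "v' \<in> lists \<Sigma>" using z(1) rstep_lists[OF T] by blast
    then show ?thesis using z s by (meson converse_rtrancl_into_rtrancl)
  qed
qed

section \<open>The Cayley graph of a system with short left-hand sides\<close>

text \<open>The starting vertex is left out: the walk is
  \<open>u # partial_products G u as\<close>.\<close>

primrec partial_products :: "('g, 'b) monoid_scheme \<Rightarrow> 'g \<Rightarrow> 'g list \<Rightarrow> 'g list" where
  "partial_products G u [] = []"
| "partial_products G u (a # as) = (u \<otimes>\<^bsub>G\<^esub> a) # partial_products G (u \<otimes>\<^bsub>G\<^esub> a) as"

lemma (in group) last_partial_products:
  assumes "u \<in> carrier G" "set as \<subseteq> carrier G"
  shows "last (u # partial_products G u as) = u \<otimes> foldr (\<otimes>) as \<one>"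
proof -
  have c: "set as \<subseteq> carrier G \<Longrightarrow> foldr (\<otimes>) as \<one> \<in> carrier G" for as
    by (induction as) auto
  show ?thesis using assms by (induction as arbitrary: u) (auto simp: c m_assoc)
qed

lemma length_partial_products: "length (partial_products G u as) = length as"
  by (induction as arbitrary: u) auto

locale short_presentation = group G for G (structure) +
  fixes \<Sigma> :: "'x set" and T :: "('x list \<times> 'x list) set" and \<phi> :: "'x list \<Rightarrow> 'a"
  assumes finite_system: "finite_rs \<Sigma> T"
    and confluent: "confluent \<Sigma> T"
    and length_reducing: "length_reducing T"
    and short: "(l, r) \<in> T \<Longrightarrow> length l \<le> 3"
    and presentation: "presentation_map G \<Sigma> T \<phi>"
    and inverse_closed: "inverse_closed G \<Sigma> \<phi>"
begin

abbreviation irreducible where "irreducible \<equiv> irreducible_word T"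

lemma T_lists: "T \<subseteq> lists \<Sigma> \<times> lists \<Sigma>"
  using finite_system unfolding finite_rs_def by blast

lemma phi_carrier: "w \<in> lists \<Sigma> \<Longrightarrow> \<phi> w \<in> carrier G"
  and phi_Nil: "\<phi> [] = \<one>"
  and phi_append: "u \<in> lists \<Sigma> \<Longrightarrow> v \<in> lists \<Sigma> \<Longrightarrow> \<phi> (u @ v) = \<phi> u \<otimes> \<phi> v"
  and phi_eq_iff: "u \<in> lists \<Sigma> \<Longrightarrow> v \<in> lists \<Sigma> \<Longrightarrow> \<phi> u = \<phi> v \<longleftrightarrow> (u, v) \<in> conv T"
  and phi_surj: "\<phi> ` lists \<Sigma> = carrier G"
proof -
  note pres = presentation[unfolded presentation_map_def]
  show surj: "\<phi> ` lists \<Sigma> = carrier G" and "\<phi> [] = \<one>" using pres by simp_all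
  show "w \<in> lists \<Sigma> \<Longrightarrow> \<phi> w \<in> carrier G" using surj by blast
  show "u \<in> lists \<Sigma> \<Longrightarrow> v \<in> lists \<Sigma> \<Longrightarrow> \<phi> (u @ v) = \<phi> u \<otimes> \<phi> v"
    "u \<in> lists \<Sigma> \<Longrightarrow> v \<in> lists \<Sigma> \<Longrightarrow> \<phi> u = \<phi> v \<longleftrightarrow> (u, v) \<in> conv T"
    using pres by simp_all
qed

lemma phi_Cons: "a \<in> \<Sigma> \<Longrightarrow> w \<in> lists \<Sigma> \<Longrightarrow> \<phi> (a # w) = \<phi> [a] \<otimes> \<phi> w"
  using phi_append[of "[a]" w] by simp

lemma phi_foldr: "w \<in> lists \<Sigma> \<Longrightarrow> \<phi> w = foldr (\<otimes>) (map (\<lambda>a. \<phi> [a]) w) \<one>"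
proof (induction w)
  case (Cons a w)
  then show ?case using phi_Cons[of a w] by simp
qed (simp add: phi_Nil)

lemma rsteps_phi: "(u, v) \<in> (rstep T)\<^sup>* \<Longrightarrow> u \<in> lists \<Sigma> \<Longrightarrow> \<phi> u = \<phi> v"
  using phi_eq_iff rsteps_lists[OF T_lists] rsteps_conv by blast

text \<open>A common descendant of \<open>q\<close> and \<open>p\<close> must be \<open>p\<close>
  itself, so \<open>q\<close> rewrites to \<open>p\<close>; any actual step would make
  \<open>q\<close> longer than \<open>p\<close>.\<close>

lemma irreducible_shortest:
  assumes "irreducible p" "p \<in> lists \<Sigma>" "q \<in> lists \<Sigma>" "\<phi> q = \<phi> p" "length q \<le> length p"
  shows "q = p"
proof -
  have "(q, p) \<in> conv T" using phi_eq_iff assms by blast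
  then obtain z where "(q, z) \<in> (rstep T)\<^sup>*" "(p, z) \<in> (rstep T)\<^sup>*"
    using church_rosser[OF T_lists confluent _ assms(3)] by blast
  then have "(q, p) \<in> (rstep T)\<^sup>*" using irreducible_rsteps assms(1) by blast
  then show ?thesis using rsteps_length[OF length_reducing] assms(5) by force
qed

text \<open>A reducible letter can only rewrite to the empty word. The remaining letters are
  nontrivial and still closed under inverses, so their Cayley graph is undirected and has no
  loops.\<close>

definition S where "S = {a \<in> \<Sigma>. irreducible [a]}"

lemma irreducible_letters:
  assumes "irreducible w" "w \<in> lists \<Sigma>"
  shows "w \<in> lists S"
  unfolding in_lists_conv_set
proof
  fix a assume "a \<in> set w"
  then have w: "irreducible w" "w \<in> lists \<Sigma>" "a \<in> set w" using assms by auto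
  then obtain u v where "w = u @ [a] @ v" using split_list by fastforce
  then show "a \<in> S" using w irreducible_word_subword unfolding S_def by blast
qed

lemma normal_form:
  assumes "w \<in> lists \<Sigma>"
  obtains z where "z \<in> lists S" "irreducible z" "\<phi> z = \<phi> w" "length z \<le> length w"
proof -
  obtain z where z: "(w, z) \<in> (rstep T)\<^sup>*" "irreducible z"
    using normal_form_exists[OF length_reducing] by blast
  show thesis
    using that[OF irreducible_letters[OF z(2)] z(2)] rsteps_lists[OF T_lists z(1) assms]
      rsteps_phi[OF z(1) assms] rsteps_length[OF length_reducing z(1)] by force
qed

lemma S_Sigma: "a \<in> S \<Longrightarrow> a \<in> \<Sigma>" "w \<in> lists S \<Longrightarrow> w \<in> lists \<Sigma>"
  unfolding S_def by auto

lemma S_carrier: "a \<in> S \<Longrightarrow> \<phi> [a] \<in> carrier G"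
  using phi_carrier S_Sigma by simp

lemma S_nontrivial: "a \<in> S \<Longrightarrow> \<phi> [a] \<noteq> \<one>"
  using irreducible_shortest[of "[a]" "[]"] phi_Nil unfolding S_def by auto

lemma not_S_trivial:
  assumes "a \<in> \<Sigma>" "a \<notin> S"
  shows "\<phi> [a] = \<one>"
proof -
  obtain z where z: "z \<in> lists S" "irreducible z" "\<phi> z = \<phi> [a]" "length z \<le> length [a]"
    using normal_form[of "[a]"] assms by auto
  have "z = []"
  proof (rule ccontr)
    assume "z \<noteq> []"
    then have "length z = length [a]" using z by (cases z) auto
    then have "[a] = z" using irreducible_shortest[of z "[a]"] z S_Sigma assms by simp
    then show False using z(1) assms by auto
  qed
  then show ?thesis using z phi_Nil by simp
qed

lemma S_inv:
  assumes "a \<in> S"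
  obtains b where "b \<in> S" "\<phi> [b] = inv (\<phi> [a])"
proof -
  obtain b where b: "b \<in> \<Sigma>" "\<phi> [b] = inv (\<phi> [a])"
    using inverse_closed S_Sigma assms unfolding inverse_closed_def by blast
  then have "\<phi> [b] \<noteq> \<one>" using S_nontrivial assms S_carrier by (metis inv_eq_1_iff)
  then show thesis using that b not_S_trivial by blast
qed

section \<open>The right Cayley graph and its local geodesics\<close>

definition E where
  "E u v \<longleftrightarrow> u \<in> carrier G \<and> (\<exists>a\<in>S. v = u \<otimes> \<phi> [a])"

lemma E_carrier: "E u v \<Longrightarrow> u \<in> carrier G" "E u v \<Longrightarrow> v \<in> carrier G"
  unfolding E_def using S_carrier by auto

lemma E_sym: "E u v \<Longrightarrow> E v u"
proof -
  assume "E u v"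
  then obtain a where a: "a \<in> S" "v = u \<otimes> \<phi> [a]" "u \<in> carrier G" unfolding E_def by blast
  obtain b where b: "b \<in> S" "\<phi> [b] = inv (\<phi> [a])" using S_inv a by blast
  have "u = v \<otimes> \<phi> [b]" using a b S_carrier by (simp add: m_assoc)
  moreover have "v \<in> carrier G" using a S_carrier by simp
  ultimately show "E v u" using b unfolding E_def by blast
qed

lemma E_irrefl: "\<not> E u u"
proof
  assume "E u u"
  then obtain a where a: "a \<in> S" "u \<otimes> \<phi> [a] = u" "u \<in> carrier G" unfolding E_def by metis
  then have "\<phi> [a] = \<one>" using S_carrier l_cancel_one by blast
  then show False using S_nontrivial a by blast
qed

abbreviation "walk u w \<equiv> partial_products G u (map (\<lambda>a. \<phi> [a]) w)"

lemma last_walk: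
  assumes "u \<in> carrier G" "w \<in> lists \<Sigma>"
  shows "last (u # walk u w) = u \<otimes> \<phi> w"
proof -
  have "\<phi> [a] \<in> carrier G" if "a \<in> set w" for a
    using that assms by (intro phi_carrier) auto
  then have "set (map (\<lambda>a. \<phi> [a]) w) \<subseteq> carrier G" by auto
  then show ?thesis using last_partial_products assms phi_foldr by metis
qed

lemma walkE:
  assumes "u \<in> carrier G" "successively E (u # vs)"
  obtains w where "w \<in> lists S" "vs = walk u w"
  using assms
proof (induction vs arbitrary: u thesis)
  case Nil
  then show ?case using Nil(1)[of "[]"] by simp
next
  case (Cons v vs)
  then obtain a where a: "a \<in> S" "v = u \<otimes> \<phi> [a]" by (auto simp: E_def)
  obtain w where w: "w \<in> lists S" "vs = walk v w"
    using Cons.IH[of v] Cons.prems S_carrier a by (auto simp: successively_Cons)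
  show ?case using Cons.prems(1)[of "a # w"] a w by simp
qed

lemma near_short:
  assumes "u \<in> carrier G" "w \<in> lists \<Sigma>"
  shows "length w \<le> 1 \<Longrightarrow> near1 E u (u \<otimes> \<phi> w)" "length w \<le> 2 \<Longrightarrow> near2 E u (u \<otimes> \<phi> w)"
proof -
  obtain z where z: "z \<in> lists S" "\<phi> z = \<phi> w" "length z \<le> length w"
    using normal_form[OF assms(2)] by blast
  have 1: "near1 E u (u \<otimes> \<phi> z)" if l: "length z \<le> 1"
  proof (cases z)
    case Nil then show ?thesis using assms phi_Nil by (simp add: near1_def)
  next
    case (Cons a z')
    then have "z = [a]" "a \<in> S" using l z by auto
    then show ?thesis using assms by (auto simp: near1_def E_def)
  qed
  then show "length w \<le> 1 \<Longrightarrow> near1 E u (u \<otimes> \<phi> w)" using z by auto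
  show "near2 E u (u \<otimes> \<phi> w)" if "length w \<le> 2"
  proof (cases "length z \<le> 1")
    case True then show ?thesis using 1 z by (auto simp: near2_def)
  next
    case False
    then have l: "length z = 2" using z that by simp
    then obtain a b where ab: "z = [a, b]" by (auto simp: numeral_2_eq_2 length_Suc_conv)
    then have "a \<in> S" "b \<in> S" using z by auto
    then have "E u (u \<otimes> \<phi> [a])" "E (u \<otimes> \<phi> [a]) (u \<otimes> \<phi> [a] \<otimes> \<phi> [b])"
      using assms S_carrier by (auto simp: E_def)
    moreover have "u \<otimes> \<phi> [a] \<otimes> \<phi> [b] = u \<otimes> \<phi> w"
      using z ab \<open>a \<in> S\<close> \<open>b \<in> S\<close> S_carrier S_Sigma assms phi_Cons[of a "[b]"] by (simp add: m_assoc)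
    ultimately show ?thesis unfolding near2_def by metis
  qed
qed

text \<open>A left-hand side inside the word spells a subwalk of at most three edges, and the
  shorter right-hand side would be a shortcut for it. This is where the bound on left-hand sides
  enters.\<close>

lemma local_geodesic_irreducible:
  assumes "u \<in> carrier G" "w \<in> lists S" "local_geodesic E (u # walk u w)"
  shows "irreducible w"
  using assms
proof (induction w arbitrary: u)
  case Nil
  then show ?case
    using rstep_length[OF length_reducing, of "[]"] unfolding irreducible_word_def by auto
next
  case (Cons a w)
  have aw: "a \<in> S" "w \<in> lists S" "a \<in> \<Sigma>" "w \<in> lists \<Sigma>" "\<phi> [a] \<in> carrier G"
    using Cons.prems S_Sigma S_carrier by auto
  have g: "local_geodesic E (u # (u \<otimes> \<phi> [a]) # walk (u \<otimes> \<phi> [a]) w)" using Cons.prems by simp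
  note gD = local_geodesicD[OF g]
  have irr: "irreducible w"
    using Cons.IH[of "u \<otimes> \<phi> [a]"] gD(2) aw Cons.prems(1) by blast
  show ?case
    unfolding irreducible_word_def
  proof (intro allI notI)
    fix v assume "(a # w, v) \<in> rstep T"
    then obtain u1 l r v1 where s: "a # w = u1 @ l @ v1" "(l, r) \<in> T"
      unfolding rstep_def by blast
    have lr: "l \<in> lists \<Sigma>" "r \<in> lists \<Sigma>" "length r < length l" "length l \<le> 3"
      using s(2) T_lists length_reducing short unfolding length_reducing_def by auto
    have "(l, r) \<in> rstep T" using rule_rstep[OF s(2)] .
    then have phi: "\<phi> l = \<phi> r" using rsteps_phi lr by blast
    show False
    proof (cases u1)
      \<comment> \<open>A left-hand side that avoids the first letter lies in the tail, irreducible
        by induction.\<close>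
      case (Cons x u2)
      then have "w = u2 @ l @ v1" using s by simp
      then have "irreducible l" using irr irreducible_word_subword by blast
      then show False using \<open>(l, r) \<in> rstep T\<close> unfolding irreducible_word_def by blast
    next
      case Nil
      then have p: "a # w = l @ v1" using s by simp
      have "l \<noteq> []" using lr by auto
      then obtain l' where l: "l = a # l'" "w = l' @ v1" using p by (cases l) auto
      consider "l' = []" | b where "l' = [b]" | b c where "l' = [b, c]"
        using lr(4) l by (cases l' rule: remdups_adj.cases) auto
      then show False
      proof cases
        case 1
        then show False
          using \<open>(l, r) \<in> rstep T\<close> l aw(1) unfolding S_def irreducible_word_def by blast
      next
        case 2
        then have "b \<in> \<Sigma>" using aw l by auto
        then have "u \<otimes> \<phi> [a] \<otimes> \<phi> [b] = u \<otimes> \<phi> r"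
          using phi l 2 phi_Cons[of a "[b]"] aw Cons.prems(1) phi_carrier[of "[b]"]
          by (simp add: m_assoc)
        moreover have "near1 E u (u \<otimes> \<phi> r)"
          using near_short(1)[OF Cons.prems(1) lr(2)] lr l 2 by simp
        ultimately show False using gD(3) l 2 by simp
      next
        case 3
        then have "b \<in> \<Sigma>" "c \<in> \<Sigma>" using aw l by auto
        then have "u \<otimes> \<phi> [a] \<otimes> \<phi> [b] \<otimes> \<phi> [c] = u \<otimes> \<phi> r"
          using phi l 3 phi_Cons[of a "[b, c]"] phi_Cons[of b "[c]"] aw Cons.prems(1)
            phi_carrier[of "[b]"] phi_carrier[of "[c]"]
          by (simp add: m_assoc)
        moreover have "near2 E u (u \<otimes> \<phi> r)"
          using near_short(2)[OF Cons.prems(1) lr(2)] lr l 3 by simp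
        ultimately show False using gD(4) l 3 by simp
      qed
    qed
  qed
qed

lemma local_geodesic_successively: "local_geodesic E p \<Longrightarrow> successively E p"
proof (induction p)
  case (Cons x p)
  then show ?case
    using local_geodesicD(1,2)[of E x "hd p" "tl p"] by (cases p) (auto simp: successively_Cons)
qed simp

text \<open>Walks from a vertex are spelled by words over \<open>S\<close>, and a local geodesic by
  an irreducible one, so uniqueness of walks becomes \<open>irreducible_shortest\<close>.\<close>

sublocale local_geodetic E
proof
  show "E y x" if "E x y" for x y using that by (rule E_sym)
  show "\<not> E x x" for x by (rule E_irrefl)
  fix p q
  assume p: "local_geodesic E p" and q: "q \<noteq> []" "successively E q"
    and eq: "hd q = hd p" "last q = last p" "length q \<le> length p"
  obtain u vs where u: "p = u # vs" using p by (cases p) auto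
  obtain vs' where u': "q = u # vs'" using q eq u by (cases q) auto
  show "q = p"
  proof (cases vs)
    case Nil
    then show ?thesis using u u' eq by simp
  next
    case (Cons v ws)
    then have uc: "u \<in> carrier G" using local_geodesicD(1)[of E u v ws] p u E_carrier by blast
    obtain w where w: "w \<in> lists S" "vs = walk u w"
      using walkE[OF uc] local_geodesic_successively p u by blast
    obtain w' where w': "w' \<in> lists S" "vs' = walk u w'"
      using walkE[OF uc] q u' by blast
    have "irreducible w" using local_geodesic_irreducible[OF uc w(1)] p u w by blast
    moreover have "u \<otimes> \<phi> w' = u \<otimes> \<phi> w"
      using last_walk[OF uc] S_Sigma w w' eq u u' by metis
    then have "\<phi> w' = \<phi> w" using uc phi_carrier S_Sigma w w' by simp
    ultimately have "w' = w"
      using irreducible_shortest S_Sigma w w' eq(3) u u' by (simp add: length_partial_products)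
    then show ?thesis using u u' w w' by simp
  qed
qed

section \<open>Left translations and the blocks at the identity\<close>

lemma E_translate:
  assumes "g \<in> carrier G" "u \<in> carrier G" "v \<in> carrier G"
  shows "E (g \<otimes> u) (g \<otimes> v) \<longleftrightarrow> E u v"
proof -
  have "g \<otimes> v = g \<otimes> u \<otimes> \<phi> [a] \<longleftrightarrow> v = u \<otimes> \<phi> [a]" if "a \<in> S" for a
    using assms S_carrier[OF that] by (simp add: m_assoc)
  then show ?thesis using assms unfolding E_def by auto
qed

lemma near1_translate:
  assumes "g \<in> carrier G" "u \<in> carrier G" "v \<in> carrier G"
  shows "near1 E (g \<otimes> u) (g \<otimes> v) \<longleftrightarrow> near1 E u v"
  using E_translate[OF assms] assms by (simp add: near1_def)

lemma same_block_translate: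
  assumes g: "g \<in> carrier G" and uv: "u \<in> carrier G" "v \<in> carrier G" and D: "same_block u v"
  shows "same_block (g \<otimes> u) (g \<otimes> v)"
proof (cases "near1 E u v")
  case True
  then show ?thesis using near1_translate g uv same_block_near1 by blast
next
  case False
  then obtain b d e where P: "pentagon u b v d e" using D unfolding same_block_def by blast
  then have "b \<in> carrier G" "d \<in> carrier G" "e \<in> carrier G"
    using E_carrier unfolding pentagon_def by blast+
  then have "pentagon (g \<otimes> u) (g \<otimes> b) (g \<otimes> v) (g \<otimes> d) (g \<otimes> e)"
    using P g uv by (simp add: pentagon_def E_translate near1_translate)
  then show ?thesis by (rule pentagon_D)
qed

definition A where "A = {g \<in> carrier G. g \<noteq> \<one> \<and> same_block \<one> g}"

lemma same_block_iff:
  assumes "u \<in> carrier G" "v \<in> carrier G"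
  shows "same_block u v \<longleftrightarrow> inv u \<otimes> v \<in> insert \<one> A"
proof
  assume "same_block u v"
  then have "same_block \<one> (inv u \<otimes> v)" using same_block_translate[of "inv u" u v] assms by simp
  then show "inv u \<otimes> v \<in> insert \<one> A" using assms by (simp add: A_def)
next
  assume "inv u \<otimes> v \<in> insert \<one> A"
  then have "same_block \<one> (inv u \<otimes> v)" using same_block_refl by (auto simp: A_def)
  then have "same_block (u \<otimes> \<one>) (u \<otimes> (inv u \<otimes> v))" using assms by (intro same_block_translate) auto
  then show "same_block u v" using assms by (simp add: m_assoc[symmetric])
qed

lemma A_carrier: "a \<in> A \<Longrightarrow> a \<in> carrier G"
  by (simp add: A_def)

lemma A_D_path:
  assumes "u \<in> carrier G" "as \<noteq> []" "set as \<subseteq> A"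
    "successively (\<lambda>a b. a \<otimes> b \<notin> insert \<one> A) as"
  shows "same_block_path (u # partial_products G u as)"
  using assms
proof (induction as arbitrary: u)
  case (Cons a as)
  have a: "a \<in> A" "a \<in> carrier G" using Cons.prems A_carrier by auto
  have "inv u \<otimes> (u \<otimes> a) = a" using a Cons.prems by (simp add: m_assoc[symmetric])
  then have D: "same_block u (u \<otimes> a)" "u \<noteq> u \<otimes> a"
    using same_block_iff[of u "u \<otimes> a"] a Cons.prems by (auto simp: A_def)
  show ?case
  proof (cases as)
    case Nil then show ?thesis using D by simp
  next
    case (Cons b bs)
    have b: "b \<in> carrier G" using Cons Cons.prems A_carrier by auto
    have "inv u \<otimes> (u \<otimes> a \<otimes> b) = a \<otimes> b"
      using a b Cons.prems by (simp add: m_assoc[symmetric])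
    then have "\<not> same_block u (u \<otimes> a \<otimes> b)"
      using same_block_iff[of u "u \<otimes> a \<otimes> b"] a b Cons Cons.prems by auto
    moreover have "same_block_path ((u \<otimes> a) # partial_products G (u \<otimes> a) as)"
      using Cons.IH[of "u \<otimes> a"] Cons Cons.prems a by auto
    ultimately show ?thesis using D Cons by simp
  qed
qed simp

text \<open>Vertices of a common block are within distance two, so an element of \<open>A\<close> is
  a product of at most two letters.\<close>

lemma finite_A: "finite A"
proof -
  let ?B = "(\<lambda>a. \<phi> [a]) ` S"
  have "finite S" using finite_system unfolding S_def finite_rs_def by auto
  then have "finite (?B \<union> (\<lambda>(a, b). a \<otimes> b) ` (?B \<times> ?B))" by blast
  moreover have "A \<subseteq> ?B \<union> (\<lambda>(a, b). a \<otimes> b) ` (?B \<times> ?B)"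
  proof
    fix g assume g: "g \<in> A"
    then have "near2 E \<one> g" "g \<noteq> \<one>" using same_block_near2 by (auto simp: A_def)
    then consider "E \<one> g" | z where "E \<one> z" "E z g" unfolding near2_def near1_def by blast
    then show "g \<in> ?B \<union> (\<lambda>(a, b). a \<otimes> b) ` (?B \<times> ?B)"
    proof cases
      case 1 then show ?thesis using S_carrier unfolding E_def by auto
    next
      case 2
      then obtain a b where "a \<in> S" "b \<in> S" "z = \<one> \<otimes> \<phi> [a]" "g = z \<otimes> \<phi> [b]"
        unfolding E_def by blast
      then have "g = (\<lambda>(a, b). a \<otimes> b) (\<phi> [a], \<phi> [b])" "(\<phi> [a], \<phi> [b]) \<in> ?B \<times> ?B"
        using S_carrier by auto
      then show ?thesis by blast
    qed
  qed
  ultimately show ?thesis by (rule finite_subset[rotated])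
qed

lemma generate_A: "generate G A = carrier G"
proof
  show "generate G A \<subseteq> carrier G" using A_carrier by (intro generate_incl) blast
  have "\<phi> w \<in> generate G A" if "w \<in> lists \<Sigma>" for w
    using that
  proof (induction w)
    case Nil
    then show ?case using phi_Nil generate.one by metis
  next
    case (Cons a w)
    have a: "\<phi> [a] \<in> generate G A"
    proof (cases "a \<in> S")
      case True
      then have "E \<one> (\<phi> [a])" using S_carrier by (auto simp: E_def)
      then have "\<phi> [a] \<in> A" using True S_nontrivial S_carrier same_block_edge by (simp add: A_def)
      then show ?thesis by (rule generate.incl)
    next
      case False
      then show ?thesis using not_S_trivial Cons generate.one by metis
    qed
    have "\<phi> (a # w) = \<phi> [a] \<otimes> \<phi> w" using phi_Cons Cons.hyps by blast
    then show ?case using generate.eng[OF a Cons.IH] by (simp only:)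
  qed
  then show "carrier G \<subseteq> generate G A" unfolding phi_surj[symmetric] by blast
qed

text \<open>Here \<open>block_trans\<close> is \<open>same_block_trans_at\<close> at the vertex
  \<open>\<one>\<close>. A product as in \<open>reduced_nontrivial\<close> is the end of a walk that
  changes block at every inner vertex and so does not return to its start.\<close>

sublocale blocks: block_group G A
proof
  show "A \<subseteq> carrier G" using A_carrier by blast
  show "finite A" by (rule finite_A)
  show "\<one> \<notin> A" by (simp add: A_def)
  show "generate G A = carrier G" by (rule generate_A)
  show "inv a \<in> A" if a: "a \<in> A" for a
  proof -
    have ac: "a \<in> carrier G" using A_carrier a .
    have "same_block a \<one>" using a same_block_sym by (simp add: A_def)
    then show ?thesis using a ac same_block_iff[of a \<one>] by (auto simp: A_def)
  qed
  show "inv a \<otimes> c \<in> insert \<one> A"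
    if h: "a \<in> A" "b \<in> A" "c \<in> A" "inv a \<otimes> b \<in> insert \<one> A" "inv b \<otimes> c \<in> insert \<one> A" for a b c
  proof -
    have A1: "same_block \<one> a" "same_block \<one> b" "same_block \<one> c" "b \<noteq> \<one>" using h by (simp_all add: A_def)
    have "same_block a b" "same_block b c" using h A_carrier same_block_iff by blast+
    then have "same_block a c" using same_block_trans_at A1 by blast
    then show ?thesis using same_block_iff h A_carrier by blast
  qed
  show "foldr (\<otimes>) as \<one> \<noteq> \<one>"
    if h: "as \<noteq> []" "set as \<subseteq> A" "successively (\<lambda>a b. a \<otimes> b \<notin> insert \<one> A) as" for as
  proof -
    obtain a as' where as: "as = a # as'" using h by (cases as) auto
    have "set as \<subseteq> carrier G" using h A_carrier by blast
    then have "last (\<one> # partial_products G \<one> as) = foldr (\<otimes>) as \<one>"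
      by (subst last_partial_products) (auto intro!: l_one simp: as)
    then show ?thesis using same_block_path_endpoints A_D_path[OF one_closed h] as by auto
  qed
qed

end

section \<open>Rewriting systems for plain groups\<close>

text \<open>Words of equal value rewrite to irreducible words of that value, which coincide by
  \<open>unique\<close>. This common descendant gives both confluence and the inclusion of the
  kernel of \<open>\<phi>\<close> in \<open>conv T\<close>.\<close>

lemma normal_forms_presentation:
  fixes G (structure)
  assumes T: "T \<subseteq> lists \<Sigma> \<times> lists \<Sigma>" and lr: "length_reducing T"
    and surj: "\<phi> ` lists \<Sigma> = carrier G" and Nil: "\<phi> [] = \<one>"
    and hom: "\<And>u v. u \<in> lists \<Sigma> \<Longrightarrow> v \<in> lists \<Sigma> \<Longrightarrow> \<phi> (u @ v) = \<phi> u \<otimes> \<phi> v"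
    and rules: "\<And>l r. (l, r) \<in> T \<Longrightarrow> \<phi> l = \<phi> r"
    and unique: "\<And>u v. \<lbrakk>irreducible_word T u; irreducible_word T v; u \<in> lists \<Sigma>; v \<in> lists \<Sigma>; \<phi> u = \<phi> v\<rbrakk>
                   \<Longrightarrow> u = v"
  shows "confluent \<Sigma> T" "presentation_map G \<Sigma> T \<phi>"
proof -
  have rstep_phi: "\<phi> u = \<phi> v" if uv: "(u, v) \<in> rstep T" and u: "u \<in> lists \<Sigma>" for u v
  proof -
    obtain x l r y where w: "u = x @ l @ y" "v = x @ r @ y" "(l, r) \<in> T"
      using uv unfolding rstep_def by blast
    then have "x \<in> lists \<Sigma>" "y \<in> lists \<Sigma>" "l \<in> lists \<Sigma>" "r \<in> lists \<Sigma>" using u T by auto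
    then show ?thesis using w(1,2) hom rules[OF w(3)] by simp
  qed
  have steps: "\<phi> u = \<phi> v" if "(u, v) \<in> (rstep T)\<^sup>*" "u \<in> lists \<Sigma>" for u v
    using that
  proof (induction rule: rtrancl_induct)
    case (step v w)
    then show ?case using rsteps_lists[OF T step(1)] rstep_phi[OF step(2)] by simp
  qed simp
  have join: "\<exists>z. (u, z) \<in> (rstep T)\<^sup>* \<and> (v, z) \<in> (rstep T)\<^sup>*"
    if uv: "u \<in> lists \<Sigma>" "v \<in> lists \<Sigma>" "\<phi> u = \<phi> v" for u v
  proof -
    obtain y where y: "(u, y) \<in> (rstep T)\<^sup>*" "irreducible_word T y" by (rule normal_form_exists[OF lr])
    obtain z where z: "(v, z) \<in> (rstep T)\<^sup>*" "irreducible_word T z" by (rule normal_form_exists[OF lr])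
    have "y = z"
      using unique[OF y(2) z(2)] rsteps_lists[OF T] steps y(1) z(1) uv by metis
    then show ?thesis using y z by blast
  qed
  show "confluent \<Sigma> T"
    unfolding confluent_def
  proof (intro ballI allI impI, elim conjE)
    fix w x y assume w: "w \<in> lists \<Sigma>" and "(w, x) \<in> (rstep T)\<^sup>*" "(w, y) \<in> (rstep T)\<^sup>*"
    then show "\<exists>z. (x, z) \<in> (rstep T)\<^sup>* \<and> (y, z) \<in> (rstep T)\<^sup>*"
      using join rsteps_lists[OF T _ w] steps[OF _ w] by metis
  qed
  have conv: "v \<in> lists \<Sigma> \<and> \<phi> u = \<phi> v" if "(u, v) \<in> conv T" "u \<in> lists \<Sigma>" for u v
    using that unfolding conv_def
  proof (induction rule: rtrancl_induct)
    case (step v w)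
    then have v: "v \<in> lists \<Sigma>" "\<phi> u = \<phi> v" by auto
    from step(2) consider "(v, w) \<in> rstep T" | "(w, v) \<in> rstep T" by blast
    then show ?case
      by cases (use v rstep_lists[OF T] rstep_phi in metis)+
  qed simp
  have conv_sym: "(v, u) \<in> conv T" if "(u, v) \<in> conv T" for u v
    using that sym_rtrancl[OF sym_Un_converse[of "rstep T"]] unfolding conv_def by (rule symD[rotated])
  have "(u, v) \<in> conv T" if uv: "u \<in> lists \<Sigma>" "v \<in> lists \<Sigma>" "\<phi> u = \<phi> v" for u v
  proof -
    obtain z where "(u, z) \<in> (rstep T)\<^sup>*" "(v, z) \<in> (rstep T)\<^sup>*" using join[OF uv] by blast
    then have "(u, z) \<in> conv T" "(z, v) \<in> conv T" using rsteps_conv conv_sym by blast+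
    then show ?thesis unfolding conv_def by (rule rtrancl_trans)
  qed
  then show "presentation_map G \<Sigma> T \<phi>"
    unfolding presentation_map_def using surj Nil hom conv by blast
qed

lemma (in group) infinite_generate_pow:
  assumes "infinite (generate G {g})" "g \<in> carrier G"
  shows "g [^] Suc k \<noteq> \<one>"
  using pow_eq_id[of g "Suc k"] generate_pow_card[of g] assms by auto

locale plain_decomposition = group G for G (structure) +
  fixes n :: nat and H :: "nat \<Rightarrow> 'a set"
  assumes free_product: "free_product_of G n H"
    and factors: "i < n \<Longrightarrow> finite (H i) \<or> infinite_cyclic_subgroup G (H i)"
begin

lemma H_subgroup: "i < n \<Longrightarrow> subgroup (H i) G"
  and H_generate: "generate G (\<Union>i<n. H i) = carrier G"
  and H_free: "\<lbrakk>ws \<noteq> []; \<forall>(i, h) \<in> set ws. i < n \<and> h \<in> H i \<and> h \<noteq> \<one>;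
     successively (\<lambda>x y. fst x \<noteq> fst y) ws\<rbrakk> \<Longrightarrow> foldr (\<lambda>p acc. snd p \<otimes> acc) ws \<one> \<noteq> \<one>"
  using free_product unfolding free_product_of_def by auto

section \<open>Letters of the factors and composable pairs\<close>

definition gen where
  "gen i = (SOME g. g \<in> carrier G \<and> H i = generate G {g})"

lemma gen:
  assumes "i < n" "infinite (H i)"
  shows "gen i \<in> carrier G" "H i = generate G {gen i}"
proof -
  have "\<exists>g. g \<in> carrier G \<and> H i = generate G {g}"
    using factors[OF assms(1)] assms(2) unfolding infinite_cyclic_subgroup_def by blast
  then have "gen i \<in> carrier G \<and> H i = generate G {gen i}"
    unfolding gen_def by (rule someI_ex)
  then show "gen i \<in> carrier G" "H i = generate G {gen i}" by auto
qed

lemma gen_pow: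
  assumes "i < n" "infinite (H i)" "g = gen i \<or> g = inv (gen i)"
  shows "g [^] Suc k \<noteq> \<one>"
proof -
  have "gen i [^] Suc k \<noteq> \<one>" using infinite_generate_pow gen assms by metis
  then show ?thesis using assms gen nat_pow_inv by (metis inv_eq_1_iff nat_pow_closed)
qed

definition letters where
  "letters i = (if finite (H i) then H i - {\<one>} else {gen i, inv (gen i)})"

lemma H_carrier: "i < n \<Longrightarrow> h \<in> H i \<Longrightarrow> h \<in> carrier G"
  using subgroup.mem_carrier[OF H_subgroup] .

lemma letters_H:
  assumes i: "i < n" and h: "h \<in> letters i"
  shows "h \<in> H i" "h \<noteq> \<one>" "h \<in> carrier G" "inv h \<in> letters i"
proof -
  have "h \<in> H i \<and> h \<noteq> \<one> \<and> inv h \<in> letters i"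
  proof (cases "finite (H i)")
    case True
    then show ?thesis
      using h subgroup.m_inv_closed[OF H_subgroup[OF i]] H_carrier[OF i] by (auto simp: letters_def)
  next
    case False
    note g = gen[OF i False]
    have "gen i \<in> H i" using g(2) generate.incl[of "gen i"] by blast
    then have "gen i \<in> H i" "inv (gen i) \<in> H i"
      using subgroup.m_inv_closed[OF H_subgroup[OF i]] by auto
    moreover have "gen i \<noteq> \<one>" using gen_pow[OF i False, of "gen i" 0] g by simp
    ultimately show ?thesis using h False g by (auto simp: letters_def)
  qed
  then show "h \<in> H i" "h \<noteq> \<one>" "h \<in> carrier G" "inv h \<in> letters i" using H_carrier[OF i] by auto
qed

text \<open>These pairs become the left-hand sides of length two. In a finite factor every pair of
  letters qualifies, in an infinite cyclic one only a generator with its inverse.\<close>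

definition composable where
  "composable p q \<longleftrightarrow> fst p = fst q \<and> snd p \<otimes> snd q \<in> insert \<one> (letters (fst p))"

definition good where
  "good ps \<longleftrightarrow> set ps \<subseteq> Sigma {..<n} letters \<and> successively (\<lambda>p q. \<not> composable p q) ps"

definition val where
  "val ps = foldr (\<lambda>p acc. snd p \<otimes> acc) ps \<one>"

lemma composable_finite:
  assumes "p \<in> Sigma {..<n} letters" "q \<in> Sigma {..<n} letters" "fst p = fst q" "finite (H (fst p))"
  shows "composable p q"
proof -
  have "snd p \<in> H (fst p)" "snd q \<in> H (fst p)" "fst p < n" using assms letters_H(1) by fastforce+
  then have "snd p \<otimes> snd q \<in> H (fst p)" using subgroup.m_closed[OF H_subgroup] by blast
  then show ?thesis using assms unfolding composable_def letters_def by auto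
qed

lemma not_composable_infinite:
  assumes "p \<in> Sigma {..<n} letters" "q \<in> Sigma {..<n} letters" "fst p = fst q" "infinite (H (fst p))"
    "snd p \<otimes> snd q \<noteq> \<one>"
  shows "snd p = snd q" "\<not> composable p q"
proof -
  let ?g = "gen (fst p)"
  have i: "fst p < n" using assms by auto
  have g: "?g \<in> carrier G" using gen i assms by blast
  have pq: "snd p \<in> {?g, inv ?g}" "snd q \<in> {?g, inv ?g}" using assms by (auto simp: letters_def)
  show eq: "snd p = snd q" using pq assms(5) g by auto
  have c: "snd p \<in> carrier G" using pq g by auto
  show "\<not> composable p q"
  proof
    assume "composable p q"
    then have "snd p \<otimes> snd p \<in> {snd p, inv (snd p)}"
      using assms eq pq g unfolding composable_def letters_def by auto
    \<comment> \<open>The first power excludes that the square of the letter is the letter, the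
      third that it is its inverse.\<close>
    moreover have "snd p [^] Suc 0 \<noteq> \<one>" "snd p [^] Suc (Suc (Suc 0)) \<noteq> \<one>"
      using gen_pow[OF i assms(4)] pq by blast+
    ultimately show False using c by (auto simp: m_assoc)
  qed
qed

lemma Sigma_lettersD:
  assumes "p \<in> Sigma {..<n} letters"
  shows "fst p < n" "snd p \<in> letters (fst p)" "snd p \<in> H (fst p)" "snd p \<noteq> \<one>" "snd p \<in> carrier G"
  using assms letters_H by auto

lemma val_carrier: "set ps \<subseteq> Sigma {..<n} letters \<Longrightarrow> val ps \<in> carrier G"
  by (induction ps) (auto simp: val_def dest: letters_H(3))

definition alternating where
  "alternating ws \<longleftrightarrow> (\<forall>p \<in> set ws. fst p < n \<and> snd p \<in> H (fst p) \<and> snd p \<noteq> \<one>) \<and>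
     successively (\<lambda>x y. fst x \<noteq> fst y) ws"

text \<open>Equal consecutive letters of an infinite cyclic factor merge into a power,
  which turns a good word into an alternating word of syllables.\<close>
lemma good_syllables:
  assumes "good ps" "ps \<noteq> []"
  shows "\<exists>k ws. val ps = val ((fst (hd ps), snd (hd ps) [^] Suc k) # ws) \<and>
     alternating ((fst (hd ps), snd (hd ps) [^] Suc k) # ws)"
  using assms
proof (induction ps)
  case (Cons p ps)
  have p: "p \<in> Sigma {..<n} letters" using Cons.prems by (simp add: good_def)
  note pD = Sigma_lettersD[OF p]
  show ?case
  proof (cases ps)
    case Nil
    then show ?thesis
      using pD by (intro exI[of _ 0] exI[of _ "[]"]) (simp add: val_def alternating_def)
  next
    case (Cons q qs)
    have q: "q \<in> Sigma {..<n} letters" and npq: "\<not> composable p q" and gps: "good ps"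
      using Cons Cons.prems by (simp_all add: good_def)
    note qD = Sigma_lettersD[OF q]
    obtain k ws where ws: "val ps = val ((fst q, snd q [^] Suc k) # ws)"
      "alternating ((fst q, snd q [^] Suc k) # ws)"
      using Cons.IH[OF gps] Cons by auto
    have vp: "val (p # ps) = snd p \<otimes> val ps" by (simp add: val_def)
    show ?thesis
    proof (cases "fst p = fst q")
      case False
      then have "alternating ((fst p, snd p) # (fst q, snd q [^] Suc k) # ws)"
        using ws(2) pD by (simp add: alternating_def)
      moreover have "val (p # ps) = val ((fst p, snd p) # (fst q, snd q [^] Suc k) # ws)"
        using vp ws(1) by (simp add: val_def)
      moreover have "snd p [^] Suc 0 = snd p" using pD by simp
      ultimately show ?thesis by (metis list.sel(1))
    next
      case True
      \<comment> \<open>A finite factor would make the pair composable. So both letters are the same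
        generator or inverse generator, and the exponent of the first syllable grows by one.\<close>
      have inf: "infinite (H (fst p))" using composable_finite[OF p q True] npq by blast
      have "snd p \<otimes> snd q \<noteq> \<one>" using npq True unfolding composable_def by auto
      then have eq: "snd p = snd q" using not_composable_infinite[OF p q True inf] by blast
      have pg: "snd p = gen (fst p) \<or> snd p = inv (gen (fst p))"
        using pD(2) inf by (simp add: letters_def)
      have "val ws \<in> carrier G"
      proof -
        have "\<forall>p \<in> set ws. snd p \<in> carrier G" using ws(2) H_carrier by (auto simp: alternating_def)
        then show ?thesis by (induction ws) (auto simp: val_def)
      qed
      then have v: "val (p # ps) = val ((fst p, snd p [^] Suc (Suc k)) # ws)"
        using vp ws(1) eq pD(5) nat_pow_Suc2[OF pD(5), of "Suc k"]
        by (simp add: val_def m_assoc del: nat_pow_Suc)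
      have "snd p [^] Suc (Suc k) \<noteq> \<one>" using gen_pow[OF pD(1) inf pg] .
      moreover have "snd p [^] Suc (Suc k) \<in> H (fst p)"
      proof -
        have "snd p [^] Suc k \<in> H (fst p)"
          using ws(2) True eq by (simp add: alternating_def del: nat_pow_Suc)
        then show ?thesis
          using subgroup.m_closed[OF H_subgroup[OF pD(1)] _ pD(3), of "snd p [^] Suc k"] by simp
      qed
      ultimately have "alternating ((fst p, snd p [^] Suc (Suc k)) # ws)"
        using ws(2) True pD(1) by (simp add: alternating_def successively_Cons del: nat_pow_Suc)
      with v show ?thesis by (metis list.sel(1))
    qed
  qed
qed simp

lemma good_nontrivial:
  assumes "good ps" "ps \<noteq> []"
  shows "val ps \<noteq> \<one>"
proof -
  obtain ws where ws: "ws \<noteq> []" "val ps = val ws" "alternating ws"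
    using good_syllables[OF assms] by blast
  then show ?thesis using H_free[of ws] unfolding alternating_def val_def by (auto simp: split_beta)
qed

definition inv_word where
  "inv_word ps = rev (map (\<lambda>p. (fst p, inv (snd p))) ps)"

lemma val_append:
  assumes "set ps \<subseteq> Sigma {..<n} letters" "set qs \<subseteq> Sigma {..<n} letters"
  shows "val (ps @ qs) = val ps \<otimes> val qs"
  using assms
proof (induction ps)
  case Nil
  then show ?case using val_carrier[of qs] by (simp add: val_def)
next
  case (Cons p ps)
  then show ?case
    using val_carrier[of qs] val_carrier[of ps] Sigma_lettersD(5)[of p] by (simp add: val_def m_assoc)
qed

lemma inv_word_letters: "set ps \<subseteq> Sigma {..<n} letters \<Longrightarrow> set (inv_word ps) \<subseteq> Sigma {..<n} letters"
  unfolding inv_word_def using letters_H(4) by auto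

lemma val_inv_word:
  assumes "set ps \<subseteq> Sigma {..<n} letters"
  shows "val (inv_word ps) = inv (val ps)"
  using assms
proof (induction ps)
  case Nil
  then show ?case by (simp add: val_def inv_word_def)
next
  case (Cons p ps)
  have p: "p \<in> Sigma {..<n} letters" using Cons by simp
  have s: "set (inv_word ps) \<subseteq> Sigma {..<n} letters" "set [(fst p, inv (snd p))] \<subseteq> Sigma {..<n} letters"
    using Cons inv_word_letters Sigma_lettersD[OF p] letters_H(4) by auto
  have "inv_word (p # ps) = inv_word ps @ [(fst p, inv (snd p))]" by (simp add: inv_word_def)
  then have "val (inv_word (p # ps)) = inv (val ps) \<otimes> inv (snd p)"
    using val_append[OF s] Cons Sigma_lettersD[OF p] by (simp add: val_def)
  then show ?case
    using Sigma_lettersD[OF p] val_carrier[of ps] Cons by (simp add: val_def inv_mult_group)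
qed

lemma inv_word_good: "good ps \<Longrightarrow> good (inv_word ps)"
proof -
  assume g: "good ps"
  have "\<not> composable (fst q, inv (snd q)) (fst p, inv (snd p))"
    if h: "p \<in> set ps" "q \<in> set ps" "\<not> composable p q" for p q
  proof
    assume c: "composable (fst q, inv (snd q)) (fst p, inv (snd p))"
    have pq: "p \<in> Sigma {..<n} letters" "q \<in> Sigma {..<n} letters" using g h unfolding good_def by blast+
    note D = Sigma_lettersD[OF pq(1)] Sigma_lettersD[OF pq(2)]
    have "inv (snd p \<otimes> snd q) \<in> insert \<one> (letters (fst p))"
      using c D by (auto simp: composable_def inv_mult_group)
    then have "inv (inv (snd p \<otimes> snd q)) \<in> insert \<one> (letters (fst p))"
      using letters_H(4)[OF D(1)] by force
    then show False using h(3) c D by (auto simp: composable_def)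
  qed
  then have "successively (\<lambda>p q. \<not> composable (fst q, inv (snd q)) (fst p, inv (snd p))) ps"
    using g unfolding good_def by (auto intro: successively_mono)
  then show ?thesis
    using g inv_word_letters unfolding good_def inv_word_def by (simp add: successively_map)
qed

lemma good_append:
  assumes "good ps" "good qs" "ps \<noteq> [] \<Longrightarrow> qs \<noteq> [] \<Longrightarrow> \<not> composable (last ps) (hd qs)"
  shows "good (ps @ qs)"
  using assms unfolding good_def by (auto simp: successively_append_iff)

text \<open>Equal first letters cancel. Otherwise the inverse of \<open>qs\<close> followed by
  \<open>ps\<close> has value \<open>\<one>\<close> and is good, possibly after merging the two
  letters at the junction, which contradicts \<open>good_nontrivial\<close>.\<close>

lemma good_unique:
  assumes "good ps" "good qs" "val ps = val qs"
  shows "ps = qs"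
  using assms
proof (induction ps arbitrary: qs)
  case Nil
  then show ?case using good_nontrivial[of qs] by (auto simp: val_def)
next
  case (Cons p ps)
  show ?case
  proof (cases qs)
    case Nil
    then show ?thesis using Cons.prems good_nontrivial[of "p # ps"] by (simp add: val_def)
  next
    case (Cons q qs')
    have sets: "set (p # ps) \<subseteq> Sigma {..<n} letters" "set (q # qs') \<subseteq> Sigma {..<n} letters"
      using Cons Cons.prems by (auto simp: good_def)
    then have p: "p \<in> Sigma {..<n} letters" and q: "q \<in> Sigma {..<n} letters" by auto
    note pD = Sigma_lettersD[OF p] and qD = Sigma_lettersD[OF q]
    have g: "good ps" "good qs'" using Cons Cons.prems by (auto simp: good_def successively_Cons)
    have vc: "val ps \<in> carrier G" "val qs' \<in> carrier G" using val_carrier sets by auto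
    have veq: "snd p \<otimes> val ps = snd q \<otimes> val qs'" using Cons.prems(3) Cons by (simp add: val_def)
    show ?thesis
    proof (cases "p = q")
      case True
      then have "val ps = val qs'" using veq vc pD by simp
      then show ?thesis using Cons.IH[OF g] True Cons by simp
    next
      case False
      let ?q = "(fst q, inv (snd q))"
      have q': "?q \<in> Sigma {..<n} letters" using qD letters_H(4) by auto
      have iq: "inv_word (q # qs') = inv_word qs' @ [?q]" by (simp add: inv_word_def)
      have "composable ?q p"
      proof (rule ccontr)
        assume "\<not> composable ?q p"
        moreover have "good (inv_word (q # qs'))" using inv_word_good Cons Cons.prems by blast
        ultimately have "good (inv_word (q # qs') @ p # ps)"
          using good_append[OF _ Cons.prems(1), of "inv_word (q # qs')"] iq by simp
        moreover have "val (inv_word (q # qs') @ p # ps) = \<one>"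
          using val_append[of "inv_word (q # qs')" "p # ps"] val_inv_word sets inv_word_letters
            Cons Cons.prems(3) val_carrier by (metis l_inv)
        ultimately show False using good_nontrivial by blast
      qed
      then have i: "fst q = fst p" and m: "inv (snd q) \<otimes> snd p \<in> insert \<one> (letters (fst p))"
        unfolding composable_def by auto
      have ne: "inv (snd q) \<otimes> snd p \<noteq> \<one>"
        using False i pD qD by (metis inv_equality inv_closed inv_inv prod.expand)
      have fin: "finite (H (fst p))"
      proof (rule ccontr)
        assume "infinite (H (fst p))"
        then have "\<not> composable ?q p" by (intro not_composable_infinite(2)[OF q' p]) (use i ne in auto)
        then show False using \<open>composable ?q p\<close> by blast
      qed
      have l: "inv (snd q) \<otimes> snd p \<in> letters (fst p)" using ne m by blast
      let ?c = "(fst p, inv (snd q) \<otimes> snd p)"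
      have c: "?c \<in> Sigma {..<n} letters" using l pD by auto
      have hps: "ps \<noteq> [] \<Longrightarrow> \<not> composable p (hd ps)" and hqs: "qs' \<noteq> [] \<Longrightarrow> \<not> composable q (hd qs')"
        using Cons.prems Cons by (auto simp: good_def successively_Cons)
      \<comment> \<open>In a finite factor all pairs are composable, so goodness puts the neighbours
        of the merged letter into other factors and the merging stops there.\<close>
      have nps: "fst (hd ps) \<noteq> fst p" if "ps \<noteq> []"
        using hps[OF that] composable_finite[OF p, of "hd ps"] fin hd_in_set[OF that] sets by force
      have nqs: "fst (hd qs') \<noteq> fst p" if "qs' \<noteq> []"
        using hqs[OF that] composable_finite[OF q, of "hd qs'"] fin i hd_in_set[OF that] sets by force
      have "good (?c # ps)"
        using g(1) c nps unfolding good_def by (auto simp: successively_Cons composable_def)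
      moreover have "\<not> composable (last (inv_word qs')) ?c" if "inv_word qs' \<noteq> []"
        using that nqs by (auto simp: inv_word_def composable_def last_rev hd_map)
      ultimately have "good (inv_word qs' @ ?c # ps)"
        using good_append[OF inv_word_good[OF g(2)]] by simp
      moreover have "val (inv_word qs' @ ?c # ps) = \<one>"
      proof -
        have "val (inv_word qs' @ ?c # ps) = inv (val qs') \<otimes> (inv (snd q) \<otimes> snd p \<otimes> val ps)"
          using val_append[of "inv_word qs'" "?c # ps"] val_inv_word[of qs'] inv_word_letters[of qs']
            sets c by (simp add: val_def)
        also have "inv (snd q) \<otimes> snd p \<otimes> val ps = inv (snd q) \<otimes> (snd q \<otimes> val qs')"
          using pD qD vc veq by (simp add: m_assoc)
        also have "\<dots> = val qs'" using qD vc by (simp add: m_assoc[symmetric])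
        finally show ?thesis using vc by simp
      qed
      ultimately show ?thesis using good_nontrivial by blast
    qed
  qed
qed

section \<open>The rewriting system with natural numbers as letters\<close>

lemma finite_letters: "finite (Sigma {..<n} letters)"
  by (intro finite_SigmaI) (auto simp: letters_def)

lemma presentation_exists:
  "\<exists>(\<Sigma> :: nat set) (T :: (nat list \<times> nat list) set) \<phi>.
     finite_rs \<Sigma> T \<and> convergent \<Sigma> T \<and> length_reducing T \<and>
     (\<forall>(l, r) \<in> T. length l \<le> 3) \<and>
     presentation_map G \<Sigma> T \<phi> \<and> inverse_closed G \<Sigma> \<phi>"
proof -
  obtain dec :: "nat \<Rightarrow> nat \<times> 'a" and N where "bij_betw dec {0..<N} (Sigma {..<n} letters)"
    using ex_bij_betw_nat_finite[OF finite_letters] by blast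
  then have dec: "inj_on dec {..<N}" "dec ` {..<N} = Sigma {..<n} letters"
    by (auto simp: bij_betw_def atLeast0LessThan)
  define wt where "wt k = (if k < N then snd (dec k) else \<one>)" for k
  define \<phi> where "\<phi> w = foldr (\<lambda>k acc. wt k \<otimes> acc) w \<one>" for w
  \<comment> \<open>The letter N stands for the identity: it keeps the alphabet nonempty when G is trivial.\<close>
  define \<Sigma> where "\<Sigma> = {..N}"
  \<comment> \<open>Apart from the rule that erases \<open>N\<close>, this is the multiplication
    table of each finite factor, and cancellation of inverse generators in each infinite
    one.\<close>
  define T where "T = insert ([N], []) {([a, b], r) | a b r. a < N \<and> b < N \<and> fst (dec a) = fst (dec b) \<and>
      (r = [] \<or> (\<exists>c<N. r = [c] \<and> fst (dec c) = fst (dec a))) \<and> \<phi> [a, b] = \<phi> r}"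
  have T_lists: "T \<subseteq> lists \<Sigma> \<times> lists \<Sigma>" unfolding T_def \<Sigma>_def by auto
  have lr: "length_reducing T" unfolding T_def length_reducing_def by auto
  have T_len: "length l \<le> 2 \<and> length r \<le> 1" if "(l, r) \<in> T" for l r
    using that unfolding T_def by auto
  have decS: "dec k \<in> Sigma {..<n} letters" if "k < N" for k using that dec(2) by blast
  have wt: "wt k \<in> carrier G" for k
    using Sigma_lettersD(5)[OF decS] by (simp add: wt_def)
  have phi_c: "\<phi> w \<in> carrier G" for w by (induction w) (simp_all add: \<phi>_def wt)
  have phi_append: "\<phi> (u @ v) = \<phi> u \<otimes> \<phi> v" for u v
  proof (induction u)
    case Nil
    have "\<phi> [] = \<one>" by (simp add: \<phi>_def)
    then show ?case using phi_c by simp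
  next
    case (Cons a u)
    have "\<phi> (a # w) = wt a \<otimes> \<phi> w" for w by (simp add: \<phi>_def)
    then show ?case using Cons phi_c wt by (simp add: m_assoc)
  qed
  have phi_single: "\<phi> [k] = wt k" for k by (simp add: \<phi>_def wt)
  have phi_val: "\<phi> w = val (map dec w)" if "w \<in> lists {..<N}" for w
    using that by (induction w) (simp_all add: \<phi>_def val_def wt_def)
  have inv_letter: "\<exists>b<N. wt b = inv (wt a)" if a: "a < N" for a
  proof -
    have "(fst (dec a), inv (snd (dec a))) \<in> Sigma {..<n} letters"
      using Sigma_lettersD[OF decS[OF a]] letters_H(4) by auto
    then obtain b where "b < N" "dec b = (fst (dec a), inv (snd (dec a)))"
      using dec(2) by (metis (no_types, lifting) imageE lessThan_iff)
    then show ?thesis using a by (intro exI[of _ b]) (simp add: wt_def)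
  qed
  have inv_closed: "inverse_closed G \<Sigma> \<phi>"
    unfolding inverse_closed_def phi_single
  proof
    fix a assume "a \<in> \<Sigma>"
    then consider "a = N" | "a < N" by (auto simp: \<Sigma>_def le_less)
    then show "\<exists>b\<in>\<Sigma>. wt b = inv (wt a)"
    proof cases
      case 1
      then show ?thesis by (intro bexI[of _ N]) (simp_all add: wt_def \<Sigma>_def)
    next
      case 2
      then obtain b where "b < N" "wt b = inv (wt a)" using inv_letter by blast
      then show ?thesis by (intro bexI[of _ b]) (simp_all add: \<Sigma>_def)
    qed
  qed
  have rules: "\<phi> l = \<phi> r" if "(l, r) \<in> T" for l r
    using that unfolding T_def by (auto simp: \<phi>_def wt_def)
  \<comment> \<open>A composable pair at the head would be a left-hand side: its product is
    \<open>\<one>\<close> or a letter of the same factor, for which \<open>dec\<close> supplies a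
    code.\<close>
  have irr_good: "w \<in> lists {..<N} \<and> good (map dec w)"
    if "irreducible_word T w" "w \<in> lists \<Sigma>" for w
    using that
  proof (induction w)
    case Nil
    then show ?case by (simp add: good_def)
  next
    case (Cons a w)
    have no: "(a # w, v) \<notin> rstep T" for v using Cons.prems unfolding irreducible_word_def by blast
    have "irreducible_word T w" using irreducible_word_subword[of T "[a]" w "[]"] Cons.prems by simp
    then have IH: "w \<in> lists {..<N}" "good (map dec w)" using Cons by auto
    have "a \<noteq> N"
    proof
      assume "a = N"
      then have "([] @ [a] @ w, [] @ [] @ w) \<in> rstep T" by (intro rstepI) (simp add: T_def)
      then show False using no by simp
    qed
    then have a: "a < N" using Cons.prems by (simp add: \<Sigma>_def)
    show ?case
    proof (cases w)
      case Nil
      then show ?thesis using a decS[OF a] by (simp add: good_def)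
    next
      case (Cons b w')
      then have b: "b < N" using IH by simp
      have "\<not> composable (dec a) (dec b)"
      proof
        assume c: "composable (dec a) (dec b)"
        have ab: "\<phi> [a, b] = snd (dec a) \<otimes> snd (dec b)"
          using phi_append[of "[a]" "[b]"] phi_single a b by (simp add: wt_def)
        have "\<exists>r. ([a, b], r) \<in> T"
        proof (cases "snd (dec a) \<otimes> snd (dec b) = \<one>")
          case True
          then have "\<phi> [a, b] = \<phi> []" using ab by (simp add: \<phi>_def)
          then show ?thesis using a b c unfolding T_def composable_def by blast
        next
          case False
          then have "(fst (dec a), snd (dec a) \<otimes> snd (dec b)) \<in> Sigma {..<n} letters"
            using c Sigma_lettersD(1)[OF decS[OF a]] unfolding composable_def by blast
          then obtain d where d: "d < N" "dec d = (fst (dec a), snd (dec a) \<otimes> snd (dec b))"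
            using dec(2) by (metis (no_types, lifting) imageE lessThan_iff)
          then have "\<phi> [a, b] = \<phi> [d]" using ab phi_single by (simp add: wt_def)
          then have "([a, b], [d]) \<in> T" using a b c d unfolding T_def composable_def by auto
          then show ?thesis by blast
        qed
        then obtain r where "([a, b], r) \<in> T" by blast
        then have "([] @ [a, b] @ w', [] @ r @ w') \<in> rstep T" by (rule rstepI)
        then show False using no Cons by simp
      qed
      then show ?thesis using IH a Cons decS[OF a] by (simp add: good_def)
    qed
  qed
  have unique: "u = v"
    if h: "irreducible_word T u" "irreducible_word T v" "u \<in> lists \<Sigma>" "v \<in> lists \<Sigma>" "\<phi> u = \<phi> v" for u v
  proof -
    have u: "u \<in> lists {..<N}" "good (map dec u)" and v: "v \<in> lists {..<N}" "good (map dec v)"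
      using irr_good h by blast+
    then have "map dec u = map dec v" using good_unique phi_val h(5) by simp
    moreover have "inj_on dec (set u \<union> set v)" using u v dec(1) by (auto intro: inj_on_subset)
    ultimately show ?thesis using map_inj_on by blast
  qed
  have surj: "\<phi> ` lists \<Sigma> = carrier G"
  proof
    show "\<phi> ` lists \<Sigma> \<subseteq> carrier G" using phi_c by blast
    \<comment> \<open>Since the factors generate, it is enough that the image is a subgroup
      containing each of them.\<close>
    have sub: "subgroup (\<phi> ` lists \<Sigma>) G"
    proof (rule subgroupI)
      show "\<phi> ` lists \<Sigma> \<subseteq> carrier G" using phi_c by blast
      show "\<phi> ` lists \<Sigma> \<noteq> {}" by blast
      show "g \<otimes> h \<in> \<phi> ` lists \<Sigma>" if gh: "g \<in> \<phi> ` lists \<Sigma>" "h \<in> \<phi> ` lists \<Sigma>" for g h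
      proof -
        obtain u v where "u \<in> lists \<Sigma>" "v \<in> lists \<Sigma>" "g = \<phi> u" "h = \<phi> v" using gh by blast
        then have "g \<otimes> h = \<phi> (u @ v)" "u @ v \<in> lists \<Sigma>" using phi_append by auto
        then show ?thesis by blast
      qed
      have "\<exists>v\<in>lists \<Sigma>. \<phi> v = inv (\<phi> u)" if "u \<in> lists \<Sigma>" for u
        using that
      proof (induction u)
        case Nil
        then show ?case by (intro bexI[of _ "[]"]) (simp_all add: \<phi>_def)
      next
        case (Cons a u)
        then obtain v b where vb: "v \<in> lists \<Sigma>" "\<phi> v = inv (\<phi> u)" "b \<in> \<Sigma>" "wt b = inv (wt a)"
          using inv_closed phi_single unfolding inverse_closed_def by metis
        have "\<phi> (v @ [b]) = inv (\<phi> (a # u))"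
          using vb phi_append[of v "[b]"] phi_append[of "[a]" u] phi_single phi_c wt
          by (simp add: inv_mult_group)
        then show ?case using vb by (intro bexI[of _ "v @ [b]"]) simp_all
      qed
      then show "inv g \<in> \<phi> ` lists \<Sigma>" if "g \<in> \<phi> ` lists \<Sigma>" for g
        using that by (metis (no_types, lifting) imageE imageI)
    qed
    have lett: "h \<in> \<phi> ` lists \<Sigma>" if "i < n" "h \<in> letters i" for i h
    proof -
      have "(i, h) \<in> Sigma {..<n} letters" using that by simp
      then obtain k where k: "k < N" "dec k = (i, h)"
        using dec(2) by (metis (no_types, lifting) imageE lessThan_iff)
      then have "h = \<phi> [k]" using phi_single by (simp add: wt_def)
      moreover have "[k] \<in> lists \<Sigma>" using k by (simp add: \<Sigma>_def)
      ultimately show ?thesis by blast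
    qed
    have "H i \<subseteq> \<phi> ` lists \<Sigma>" if i: "i < n" for i
    proof (cases "finite (H i)")
      case True
      then have "H i \<subseteq> insert \<one> (letters i)" by (auto simp: letters_def)
      then show ?thesis using lett[OF i] subgroup.one_closed[OF sub] by blast
    next
      case False
      then have "gen i \<in> \<phi> ` lists \<Sigma>" using lett[OF i] by (simp add: letters_def)
      then show ?thesis using gen(2)[OF i False] generate_subgroup_incl[OF _ sub] by auto
    qed
    then have "generate G (\<Union>i<n. H i) \<subseteq> \<phi> ` lists \<Sigma>"
      by (intro generate_subgroup_incl[OF _ sub]) blast
    then show "carrier G \<subseteq> \<phi> ` lists \<Sigma>" unfolding H_generate .
  qed
  have Nil: "\<phi> [] = \<one>" by (simp add: \<phi>_def)
  have pres: "confluent \<Sigma> T" "presentation_map G \<Sigma> T \<phi>"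
    by (rule normal_forms_presentation[OF T_lists lr surj Nil phi_append rules unique]; assumption)+
  have "finite T"
  proof -
    let ?L = "\<lambda>k. {w. set w \<subseteq> \<Sigma> \<and> length w \<le> k}"
    have "finite (?L 2 \<times> ?L 1)" by (intro finite_cartesian_product finite_lists_length_le) (simp_all add: \<Sigma>_def)
    moreover have "T \<subseteq> ?L 2 \<times> ?L 1"
    proof (rule subrelI)
      fix l r assume lr: "(l, r) \<in> T"
      then have "l \<in> lists \<Sigma>" "r \<in> lists \<Sigma>" using T_lists by blast+
      then show "(l, r) \<in> ?L 2 \<times> ?L 1" using T_len[OF lr] by (simp add: in_lists_conv_set subset_iff)
    qed
    ultimately show ?thesis by (rule finite_subset[rotated])
  qed
  moreover have "finite \<Sigma>" "\<Sigma> \<noteq> {}" by (auto simp: \<Sigma>_def)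
  ultimately have "finite_rs \<Sigma> T" using T_lists unfolding finite_rs_def by blast
  moreover have "convergent \<Sigma> T"
    using pres(1) length_reducing_terminating[OF lr] unfolding convergent_def by blast
  moreover have "length l \<le> 3" if "(l, r) \<in> T" for l r using T_len[OF that] by simp
  then have "\<forall>(l, r) \<in> T. length l \<le> 3" by blast
  ultimately show ?thesis using lr pres(2) inv_closed by blast
qed

end

section \<open>The characterisation\<close>

text \<open>Alphabets are finite, so taking natural numbers as letters loses no generality.\<close>

theorem theorem1:
  fixes G :: "('g, 'b) monoid_scheme"
  assumes "group G"
  shows "(\<exists>(\<Sigma> :: nat set) (T :: (nat list \<times> nat list) set) \<phi>.
            finite_rs \<Sigma> T \<and> convergent \<Sigma> T \<and> length_reducing T \<and>
            (\<forall>(l, r) \<in> T. length l \<le> 3) \<and>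
            presentation_map G \<Sigma> T \<phi> \<and> inverse_closed G \<Sigma> \<phi>)
         \<longleftrightarrow> plain_group G"
proof
  assume "\<exists>(\<Sigma> :: nat set) (T :: (nat list \<times> nat list) set) \<phi>.
            finite_rs \<Sigma> T \<and> convergent \<Sigma> T \<and> length_reducing T \<and>
            (\<forall>(l, r) \<in> T. length l \<le> 3) \<and>
            presentation_map G \<Sigma> T \<phi> \<and> inverse_closed G \<Sigma> \<phi>"
  then obtain \<Sigma> :: "nat set" and T :: "(nat list \<times> nat list) set" and \<phi>
    where *: "finite_rs \<Sigma> T" "confluent \<Sigma> T" "length_reducing T" "\<forall>(l, r) \<in> T. length l \<le> 3"
      "presentation_map G \<Sigma> T \<phi>" "inverse_closed G \<Sigma> \<phi>"
    unfolding convergent_def by blast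
  interpret group G by fact
  interpret short_presentation G \<Sigma> T \<phi>
    by unfold_locales (use * in auto)
  show "plain_group G" by (rule blocks.plain)
next
  assume "plain_group G"
  then obtain n H where *: "free_product_of G n H"
    "\<forall>i < n. finite (H i) \<or> infinite_cyclic_subgroup G (H i)"
    unfolding plain_group_def by blast
  interpret group G by fact
  interpret plain_decomposition G n H
    by unfold_locales (use * in auto)
  show "\<exists>(\<Sigma> :: nat set) (T :: (nat list \<times> nat list) set) \<phi>.
            finite_rs \<Sigma> T \<and> convergent \<Sigma> T \<and> length_reducing T \<and>
            (\<forall>(l, r) \<in> T. length l \<le> 3) \<and>
            presentation_map G \<Sigma> T \<phi> \<and> inverse_closed G \<Sigma> \<phi>"
    by (rule presentation_exists)
qed

end
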